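(* Let $2\leq p\leq q\leq\infty$ and let $r$ be defined by $q^{-1}+r^{-1}=1$. If \[{\Gamma\left(1+\frac{p}{2}\right)}^{\frac{1}{p}}\,{\Gamma\left(1+\frac{r}{2}\right)}^{\frac{1}{r}}>1,\] then the Riesz projection $P$ is unbounded from $L^q(\mathbb{T}^\infty)$ to $L^p(\mathbb{T}^\infty)$.
   Context: $\mathbb{T}^\infty$ is the countably infinite cartesian product of $\mathbb{T}=\{z\in\mathbb{C} : |z|=1\}$, equipped with its Haar measure $\mu_\infty$ (the infinite product of the normalized Lebesgue arc measure on $\mathbb{T}$), and $L^p(\mathbb{T}^\infty)$ is taken with respect to $\mu_\infty$. Let $\mathbb{Z}_0^\infty$ (resp. $\mathbb{N}_0^\infty$) be the set of sequences of integers (resp. non-negative integers) with only finitely many non-zero components, and write $z^\alpha=\prod_j z_j^{\alpha_j}$. Every $f\in L^1(\mathbb{T}^\infty)$ has a Fourier series $f(z)=\sum_{\alpha\in\mathbb{Z}_0^\infty} c_\alpha z^\alpha$ with $c_\alpha=\int_{\mathbb{T}^\infty} f(z)\overline{z^\alpha}\,d\mu_\infty(z)$. The Riesz projection is $Pf(z)=\sum_{\alpha\in\mathbb{N}_0^\infty} c_\alpha z^\alpha$, well defined on $L^2(\mathbb{T}^\infty)\supset L^q(\mathbb{T}^\infty)$ for $q\ge2$. Unbounded means that there is no constant $C<\infty$ with $\|Pf\|_{L^p(\mathbb{T}^\infty)}\le C\|f\|_{L^q(\mathbb{T}^\infty)}$ for all $f\in L^q(\mathbb{T}^\infty)$ (with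 the convention $\|Pf\|_{L^p(\mathbb{T}^\infty)}=\infty$ if $Pf\notin L^p(\mathbb{T}^\infty)$). For $q=\infty$ one has $r=1$. *)

theory Defs
  imports "HOL-Probability.Probability"
begin

definition circle_measure :: "complex measure" where
  "circle_measure =
     distr (uniform_measure lborel {0..<2 * pi}) (restrict_space borel (sphere 0 1)) cis"

definition torus_measure :: "(nat \<Rightarrow> complex) measure" where
  "torus_measure = PiM UNIV (\<lambda>_. circle_measure)"

lemma prob_space_circle_measure: "prob_space circle_measure"
proof -
  have "prob_space (uniform_measure lborel {0..<2 * pi})"
    by (rule prob_space_uniform_measure) auto
  moreover have "cis \<in> borel_measurable borel"
    by (intro borel_measurable_continuous_onI continuous_intros)
  then have "cis \<in> uniform_measure lborel {0..<2 * pi} \<rightarrow>\<^sub>M restrict_space borel (sphere 0 1)"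
    by (intro measurable_restrict_space2) (simp_all add: measurable_def)
  ultimately show ?thesis
    unfolding circle_measure_def by (rule prob_space.prob_space_distr)
qed

lemma space_torus_measure: "space torus_measure = {z. \<forall>j. cmod (z j) = 1}"
  by (auto simp: torus_measure_def circle_measure_def space_PiM PiE_UNIV_domain space_restrict_space)

lemma prob_space_torus_measure: "prob_space torus_measure"
  unfolding torus_measure_def by (intro prob_space_PiM prob_space_circle_measure)

(* Extended-valued, and equal to \<infinity> outside the space (finite exponents: if the integral
   diverges). Only exponents p >= 1 are meaningful. *)
definition Lp_norm :: "'a measure \<Rightarrow> ennreal \<Rightarrow> ('a \<Rightarrow> complex) \<Rightarrow> ennreal" where
  "Lp_norm M p f =
     (if p = \<infinity> then esssup M (\<lambda>x. ennreal (cmod (f x)))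
      else let I = (\<integral>\<^sup>+x. ennreal (cmod (f x) powr enn2real p) \<partial>M)
           in if I = \<infinity> then \<infinity> else ennreal (enn2real I powr (1 / enn2real p)))"

definition Lp_space :: "'a measure \<Rightarrow> ennreal \<Rightarrow> ('a \<Rightarrow> complex) set" where
  "Lp_space M p = {f \<in> borel_measurable M. Lp_norm M p f < \<infinity>}"

definition Z0_inf :: "(nat \<Rightarrow> int) set" where
  "Z0_inf = {\<alpha>. finite {j. \<alpha> j \<noteq> 0}}"

definition N0_inf :: "(nat \<Rightarrow> int) set" where
  "N0_inf = {\<alpha> \<in> Z0_inf. \<forall>j. 0 \<le> \<alpha> j}"

definition monomial :: "(nat \<Rightarrow> int) \<Rightarrow> (nat \<Rightarrow> complex) \<Rightarrow> complex" where
  "monomial \<alpha> z = (\<Prod>j | \<alpha> j \<noteq> 0. z j powi \<alpha> j)"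

definition fourier_coeff :: "((nat \<Rightarrow> complex) \<Rightarrow> complex) \<Rightarrow> (nat \<Rightarrow> int) \<Rightarrow> complex" where
  "fourier_coeff f \<alpha> = (\<integral>z. f z * cnj (monomial \<alpha> z) \<partial>torus_measure)"

(* g is a representative of Pf: the series over N0_inf converges unconditionally to g in L^2.
   Functions are not identified almost everywhere, so Pf is only determined up to null sets. *)
definition is_riesz_projection ::
  "((nat \<Rightarrow> complex) \<Rightarrow> complex) \<Rightarrow> ((nat \<Rightarrow> complex) \<Rightarrow> complex) \<Rightarrow> bool" where
  "is_riesz_projection f g \<longleftrightarrow>
     f \<in> Lp_space torus_measure 2 \<and> g \<in> Lp_space torus_measure 2 \<and>
     ((\<lambda>F. Lp_norm torus_measure 2 (\<lambda>z. g z - (\<Sum>\<alpha>\<in>F. fourier_coeff f \<alpha> * monomial \<alpha> z)))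
        \<longlongrightarrow> 0) (finite_subsets_at_top N0_inf)"

(* The inequality is between extended values, so it also forces g into L^p. *)
definition riesz_projection_bounded :: "ennreal \<Rightarrow> ennreal \<Rightarrow> bool" where
  "riesz_projection_bounded q p \<longleftrightarrow>
     (\<exists>C::real. \<forall>f \<in> Lp_space torus_measure q. \<forall>g. is_riesz_projection f g \<longrightarrow>
        Lp_norm torus_measure p g \<le> ennreal C * Lp_norm torus_measure q f)"

(* Gamma(1 + t/2)^(1/t), with its limit \<infinity> as the value at t = \<infinity>. *)
definition gamma_root :: "ennreal \<Rightarrow> ennreal" where
  "gamma_root t =
     (if t = \<infinity> then \<infinity>
      else ennreal (Gamma (1 + enn2real t / 2) powr (1 / enn2real t)))"

end

theory Submission
  imports Defs
begin

text \<open>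
  Let \<open>S = (z_0 + ... + z_(n-1)) / sqrt n\<close> and \<open>f = |S|^(r-2) S\<close>. Among the non-negative exponents only
  those of the single coordinates \<open>z_j\<close>, \<open>j < n\<close>, occur in \<open>f\<close> (rotate all coordinates simultaneously), and their
  coefficients agree by symmetry, so \<open>P f = E|S|^r * S\<close> exactly. Since \<open>(r - 1) q = r\<close>, the quotient of
  the norms of \<open>P f\<close> in \<open>L^p\<close> and of \<open>f\<close> in \<open>L^q\<close> is \<open>(E|S|^r)^(1/r) (E|S|^p)^(1/p)\<close>. By the central limit
  theorem \<open>S\<close> tends to a standard complex Gaussian \<open>Z\<close>, and \<open>E|Z|^s = Gamma (1 + s/2)\<close>; so the quotient
  exceeds 1 for large \<open>n\<close>. Taking products over \<open>k\<close> disjoint blocks of variables raises it to the \<open>k\<close>-th power.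

  A one-dimensional central limit theorem suffices: the law of \<open>S\<close> is invariant under rotations, so \<open>E|Re S|^s\<close>
  is \<open>E|S|^s\<close> times the mean of \<open>|cos|^s\<close>. The case \<open>p = \<infinity>\<close> follows from \<open>p = 4\<close>, where the
  Gamma condition holds with \<open>r = 1\<close> because \<open>pi^2 > 8\<close>.
\<close>

section \<open>Invariance properties of the Haar measure\<close>

lemma sets_circle_measure: "sets circle_measure = sets (restrict_space borel (sphere 0 1))"
  by (simp add: circle_measure_def)

lemma space_circle_measure: "space circle_measure = sphere 0 1"
  by (simp add: circle_measure_def space_restrict_space)

lemma measurable_cis [measurable]: "cis \<in> borel_measurable borel"
  by (intro borel_measurable_continuous_onI continuous_intros)

lemma borel_measurable_circle_measure:
  "f \<in> borel_measurable borel \<Longrightarrow> f \<in> borel_measurable circle_measure"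
  unfolding measurable_cong_sets[OF sets_circle_measure refl]
  by (rule measurable_restrict_space1)

lemma borel_sets_circle_measure: "A \<in> sets circle_measure \<Longrightarrow> A \<in> sets borel"
  unfolding sets_circle_measure by (auto simp: sets_restrict_space)

lemma nn_integral_circle_measure:
  assumes [measurable]: "F \<in> borel_measurable borel"
  shows "(\<integral>\<^sup>+w. F w \<partial>circle_measure) =
    (\<integral>\<^sup>+x. F (cis x) * indicator {0..<2*pi} x \<partial>lborel) / ennreal (2 * pi)"
proof -
  have "cis \<in> measurable (uniform_measure lborel {0..<2 * pi}) (restrict_space borel (sphere 0 1))"
    by (intro measurable_restrict_space2) (auto simp: measurable_cong_sets[OF sets_uniform_measure refl])
  then show ?thesis
    unfolding circle_measure_def
    by (subst nn_integral_distr)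
       (auto intro!: measurable_restrict_space1 simp: nn_integral_uniform_measure)
qed

lemma nn_integral_lborel_shift:
  fixes F :: "real \<Rightarrow> ennreal"
  assumes [measurable]: "F \<in> borel_measurable borel"
  shows "(\<integral>\<^sup>+x. F (t + x) \<partial>lborel) = (\<integral>\<^sup>+x. F x \<partial>lborel)"
  using nn_integral_real_affine[of F 1 t] by simp

text \<open>The window from t to t + T is cut at T, and the piece beyond T is moved back by one
  period. Applied to angles, this gives rotation invariance of the arc measure.\<close>

lemma nn_integral_period_shift:
  fixes G :: "real \<Rightarrow> ennreal"
  assumes [measurable]: "G \<in> borel_measurable borel"
    and per: "\<And>x. G (T + x) = G x" and t: "0 \<le> t" "t \<le> T"
  shows "(\<integral>\<^sup>+x. G (t + x) * indicator {0..<T} x \<partial>lborel) = (\<integral>\<^sup>+x. G x * indicator {0..<T} x \<partial>lborel)"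
proof -
  have "(\<integral>\<^sup>+x. G (t + x) * indicator {0..<T} x \<partial>lborel)
      = (\<integral>\<^sup>+x. G (t + x) * indicator {t..<t + T} (t + x) \<partial>lborel)"
    by (intro nn_integral_cong) (auto simp: indicator_def)
  also have "\<dots> = (\<integral>\<^sup>+x. G x * indicator {t..<t + T} x \<partial>lborel)"
    by (rule nn_integral_lborel_shift) measurable
  also have "\<dots> = (\<integral>\<^sup>+x. G x * indicator {t..<T} x + G x * indicator {T..<T + t} x \<partial>lborel)"
    using t by (intro nn_integral_cong) (auto simp: indicator_def)
  also have "\<dots> = (\<integral>\<^sup>+x. G x * indicator {t..<T} x \<partial>lborel) + (\<integral>\<^sup>+x. G x * indicator {T..<T + t} x \<partial>lborel)"
    by (rule nn_integral_add) measurable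
  also have "(\<integral>\<^sup>+x. G x * indicator {T..<T + t} x \<partial>lborel)
      = (\<integral>\<^sup>+x. G (T + x) * indicator {T..<T + t} (T + x) \<partial>lborel)"
    by (rule nn_integral_lborel_shift[symmetric]) measurable
  also have "\<dots> = (\<integral>\<^sup>+x. G x * indicator {0..<t} x \<partial>lborel)"
    by (intro nn_integral_cong) (auto simp: indicator_def per)
  also have "(\<integral>\<^sup>+x. G x * indicator {t..<T} x \<partial>lborel) + \<dots>
     = (\<integral>\<^sup>+x. G x * indicator {t..<T} x + G x * indicator {0..<t} x \<partial>lborel)"
    by (rule nn_integral_add[symmetric]) measurable
  also have "\<dots> = (\<integral>\<^sup>+x. G x * indicator {0..<T} x \<partial>lborel)"
    using t by (intro nn_integral_cong) (auto simp: indicator_def)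
  finally show ?thesis .
qed

lemma ex_cis: "cmod w = 1 \<Longrightarrow> \<exists>t. 0 \<le> t \<and> t < 2 * pi \<and> w = cis t"
  using Arg2pi[of w] by (auto simp: cis_conv_exp is_Arg_def)

lemma nn_integral_circle_measure_rotate:
  assumes [measurable]: "F \<in> borel_measurable borel" and w: "cmod w = 1"
  shows "(\<integral>\<^sup>+z. F (w * z) \<partial>circle_measure) = (\<integral>\<^sup>+z. F z \<partial>circle_measure)"
proof -
  obtain t where t: "0 \<le> t" "t < 2 * pi" "w = cis t"
    using ex_cis[OF w] by auto
  have "(\<integral>\<^sup>+x. F (cis (t + x)) * indicator {0..<2*pi} x \<partial>lborel)
      = (\<integral>\<^sup>+x. F (cis x) * indicator {0..<2*pi} x \<partial>lborel)"
    using t by (intro nn_integral_period_shift[where G="\<lambda>x. F (cis x)"]) (simp_all add: cis_mult[symmetric])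
  then show ?thesis
    by (simp add: nn_integral_circle_measure t(3) cis_mult)
qed

lemma measurable_circle_rotate:
  assumes "cmod w = 1"
  shows "(*) w \<in> measurable circle_measure circle_measure"
proof -
  have "(*) w \<in> measurable circle_measure (restrict_space borel (sphere 0 1))"
    using assms by (intro measurable_restrict_space2)
      (auto simp: space_circle_measure norm_mult intro!: borel_measurable_circle_measure)
  then show ?thesis
    unfolding measurable_cong_sets[OF refl sets_circle_measure] .
qed

lemma emeasure_circle_rotate:
  assumes w: "cmod w = 1" and A: "A \<in> sets circle_measure"
  shows "emeasure circle_measure ((*) w -` A \<inter> space circle_measure) = emeasure circle_measure A"
proof -
  let ?B = "(*) w -` A \<inter> space circle_measure"
  have B: "?B \<in> sets circle_measure"
    by (rule measurable_sets[OF measurable_circle_rotate[OF w] A])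
  have "emeasure circle_measure ?B = (\<integral>\<^sup>+z. indicator ?B z \<partial>circle_measure)"
    by (rule nn_integral_indicator[OF B, symmetric])
  also have "\<dots> = (\<integral>\<^sup>+z. indicator A (w * z) \<partial>circle_measure)"
    by (rule nn_integral_cong) (simp add: indicator_def)
  also have "\<dots> = (\<integral>\<^sup>+z. indicator A z \<partial>circle_measure)"
    by (rule nn_integral_circle_measure_rotate[OF borel_measurable_indicator w])
       (rule borel_sets_circle_measure[OF A])
  also have "\<dots> = emeasure circle_measure A"
    by (rule nn_integral_indicator[OF A])
  finally show ?thesis .
qed

lemma measurable_torus_component_circle: "(\<lambda>z. z j) \<in> measurable torus_measure circle_measure"
  unfolding torus_measure_def by (rule measurable_component_singleton) simp

lemma measurable_torus_component [measurable]: "(\<lambda>z. z j) \<in> borel_measurable torus_measure"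
  using measurable_compose[OF measurable_torus_component_circle
    borel_measurable_circle_measure[OF measurable_ident]] by simp

lemma measurable_torusI:
  "(\<And>j. (\<lambda>x. f x j) \<in> measurable N circle_measure) \<Longrightarrow> f \<in> measurable N torus_measure"
  unfolding torus_measure_def by (rule measurable_PiM_single') (auto dest: measurable_space)

lemma measurable_torus_rotate:
  "(\<And>j. cmod (w j) = 1) \<Longrightarrow> (\<lambda>z j. w j * z j) \<in> measurable torus_measure torus_measure"
  by (intro measurable_torusI measurable_compose[OF measurable_torus_component_circle measurable_circle_rotate])

text \<open>A finite measure on an infinite product is determined by its values on
  finite-dimensional cylinders. There a coordinatewise rotation acts on each factor
  separately.\<close>

lemma distr_torus_rotate:
  assumes w: "\<And>j. cmod (w j) = 1"
  shows "distr torus_measure torus_measure (\<lambda>z j. w j * z j) = torus_measure"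
proof -
  interpret T: prob_space torus_measure by (rule prob_space_torus_measure)
  note PS = prob_space_circle_measure
  let ?C = "\<lambda>_::nat. circle_measure"
  let ?t = "\<lambda>z j. w j * z j"
  have "torus_measure = distr torus_measure torus_measure ?t"
  proof (rule measure_eqI_PiM_infinite[where I=UNIV and M="?C"])
    fix J :: "nat set" and A :: "nat \<Rightarrow> complex set"
    assume J: "finite J" and A: "\<And>i. i \<in> J \<Longrightarrow> A i \<in> sets circle_measure"
    let ?E = "prod_emb UNIV ?C J (Pi\<^sub>E J A)"
    let ?B = "\<lambda>i. (*) (w i) -` A i \<inter> space circle_measure"
    have sE: "?E \<in> sets torus_measure"
      unfolding torus_measure_def using J A by (intro sets_PiM_I) auto
    \<comment> \<open>The preimage of a cylinder is again a cylinder, whose sides are the sides of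
      the old one rotated back.\<close>
    have eq: "?t -` ?E \<inter> space torus_measure = prod_emb UNIV ?C J (Pi\<^sub>E J ?B)"
      using w by (auto simp: prod_emb_def space_PiM torus_measure_def space_circle_measure PiE_iff Pi_iff norm_mult)
    have "emeasure (distr torus_measure torus_measure ?t) ?E = emeasure torus_measure (prod_emb UNIV ?C J (Pi\<^sub>E J ?B))"
      using sE by (simp add: emeasure_distr measurable_torus_rotate[OF w] eq)
    also have "\<dots> = (\<Prod>i\<in>J. emeasure circle_measure (?B i))"
      unfolding torus_measure_def using J A
      by (intro emeasure_PiM_emb PS) (auto intro!: measurable_sets[OF measurable_circle_rotate[OF w]])
    also have "\<dots> = (\<Prod>i\<in>J. emeasure circle_measure (A i))"
      using A by (intro prod.cong refl emeasure_circle_rotate w)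
    also have "\<dots> = emeasure torus_measure ?E"
      unfolding torus_measure_def using J A by (intro emeasure_PiM_emb[symmetric] PS) auto
    finally show "emeasure torus_measure ?E = emeasure (distr torus_measure torus_measure ?t) ?E" ..
  qed (simp_all add: torus_measure_def[symmetric] T.finite_measure_axioms)
  then show ?thesis ..
qed

lemma measurable_torus_reindex: "(\<lambda>z j. z (\<pi> j)) \<in> measurable torus_measure torus_measure"
  by (intro measurable_torusI measurable_torus_component_circle)

text \<open>Injective reindexings cover two uses: permutations, under which coefficients are
  compared, and shifts such as j \<mapsto> i * n + j, which are not surjective and carry one block
  of variables onto another.\<close>

lemma distr_torus_reindex:
  assumes "inj \<pi>"
  shows "distr torus_measure torus_measure (\<lambda>z j. z (\<pi> j)) = torus_measure"
  using distr_PiM_reindex[of UNIV "\<lambda>_::nat. circle_measure" \<pi> UNIV] assms prob_space_circle_measure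
  by (simp add: torus_measure_def restrict_UNIV)

lemma nn_integral_torus_rotate:
  fixes F :: "(nat \<Rightarrow> complex) \<Rightarrow> ennreal"
  assumes "F \<in> borel_measurable torus_measure" "\<And>j. cmod (w j) = 1"
  shows "(\<integral>\<^sup>+z. F (\<lambda>j. w j * z j) \<partial>torus_measure) = (\<integral>\<^sup>+z. F z \<partial>torus_measure)"
  using nn_integral_distr[OF measurable_torus_rotate, of w F] assms
  by (simp add: distr_torus_rotate)

lemma integral_torus_rotate:
  fixes F :: "(nat \<Rightarrow> complex) \<Rightarrow> complex"
  assumes "F \<in> borel_measurable torus_measure" "\<And>j. cmod (w j) = 1"
  shows "(\<integral>z. F (\<lambda>j. w j * z j) \<partial>torus_measure) = (\<integral>z. F z \<partial>torus_measure)"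
  using integral_distr[OF measurable_torus_rotate, of w F] assms
  by (simp add: distr_torus_rotate)

lemma nn_integral_torus_reindex:
  fixes F :: "(nat \<Rightarrow> complex) \<Rightarrow> ennreal"
  assumes "F \<in> borel_measurable torus_measure" "inj \<pi>"
  shows "(\<integral>\<^sup>+z. F (\<lambda>j. z (\<pi> j)) \<partial>torus_measure) = (\<integral>\<^sup>+z. F z \<partial>torus_measure)"
  using nn_integral_distr[OF measurable_torus_reindex, of F \<pi>] assms
  by (simp add: distr_torus_reindex)

lemma integral_torus_reindex:
  fixes F :: "(nat \<Rightarrow> complex) \<Rightarrow> complex"
  assumes "F \<in> borel_measurable torus_measure" "inj \<pi>"
  shows "(\<integral>z. F (\<lambda>j. z (\<pi> j)) \<partial>torus_measure) = (\<integral>z. F z \<partial>torus_measure)"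
  using integral_distr[OF measurable_torus_reindex, of F \<pi>] assms
  by (simp add: distr_torus_reindex)

lemma indep_vars_torus_component:
  "prob_space.indep_vars torus_measure (\<lambda>_. circle_measure) (\<lambda>j z. z j) UNIV"
proof -
  interpret T: prob_space torus_measure by (rule prob_space_torus_measure)
  have "distr torus_measure circle_measure (\<lambda>z. z j) = circle_measure" for j
    unfolding torus_measure_def
    by (rule distr_PiM_component) (simp_all add: prob_space_circle_measure)
  then show ?thesis
    \<comment> \<open>The identity reindexing says that the joint law of all coordinates is the
      product measure itself.\<close>
    using distr_torus_reindex[of "\<lambda>j. j"]
    by (subst T.indep_vars_iff_distr_eq_PiM)
       (simp_all add: measurable_torus_component_circle torus_measure_def[symmetric] restrict_UNIV)
qed

section \<open>Absolute moments of cosine and of the Gaussian\<close>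

lemma square_powr_half: "0 < x \<Longrightarrow> (x\<^sup>2) powr (a / 2) = x powr (a::real)" for x :: real
  using powr_powr[of x 2 "a / 2"] by simp

lemma Beta_half_nonneg: "0 < s \<Longrightarrow> 0 \<le> Beta (1/2) ((s + 1)/2)" for s :: real
  unfolding Beta_def by (intro divide_nonneg_nonneg mult_nonneg_nonneg Gamma_real_nonneg add_pos_pos) auto

text \<open>Substitute t = (sin x)^2 in the Euler integral of Beta (1/2) ((s + 1)/2).\<close>

lemma nn_integral_cos_quarter:
  assumes s: "s > (0::real)"
  shows "(\<integral>\<^sup>+x. ennreal (cos x powr s) * indicator {0..pi/2} x \<partial>lborel) = ennreal (Beta (1/2) ((s + 1)/2) / 2)"
proof -
  let ?f = "\<lambda>t::real. t powr (-1/2) * (1 - t) powr ((s - 1)/2)"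
  have "((\<lambda>t. t powr (1/2 - 1) * (1 - t) powr ((s + 1)/2 - 1)) has_integral Beta (1/2) ((s+1)/2)) {0..1}"
    using s by (intro has_integral_Beta_real) auto
  also have "(\<lambda>t. t powr (1/2 - 1) * (1 - t) powr ((s + 1)/2 - 1)) = ?f"
    by (intro ext) (simp add: field_simps)
  finally have hB: "(?f has_integral Beta (1/2) ((s+1)/2)) {0..1}" .
  have "ennreal (Beta (1/2) ((s+1)/2)) = (\<integral>\<^sup>+t. ennreal (?f t * indicator {(sin 0)\<^sup>2..(sin (pi/2))\<^sup>2} t) \<partial>lborel)"
    using nn_integral_has_integral_lebesgue[OF _ hB] by (simp add: mult_ac)
  also have "\<dots> = (\<integral>\<^sup>+x. ennreal (?f ((sin x)\<^sup>2) * (2 * sin x * cos x) * indicator {0..pi/2} x) \<partial>lborel)"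
  proof (rule nn_integral_substitution)
    show "set_borel_measurable borel {(sin 0)\<^sup>2..(sin (pi / 2))\<^sup>2} ?f"
      unfolding set_borel_measurable_def by measurable
    show "((\<lambda>x. (sin x)\<^sup>2) has_real_derivative 2 * sin x * cos x) (at x)" for x :: real
      by (auto intro!: derivative_eq_intros)
    show "0 \<le> 2 * sin x * cos x" if "x \<in> {0..pi/2}" for x :: real
      using that by (auto intro!: mult_nonneg_nonneg sin_ge_zero cos_ge_zero)
  qed (auto intro!: continuous_intros)
  also have "\<dots> = (\<integral>\<^sup>+x. 2 * (ennreal (cos x powr s) * indicator {0..pi/2} x) \<partial>lborel)"
  proof (rule nn_integral_cong_AE)
    \<comment> \<open>At x = 0 the two integrands are 0 and 2, so they agree only almost everywhere.
      Without the endpoints, sin x and cos x are positive and can be cancelled.\<close>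
    have "AE x in lborel. x \<noteq> (0::real) \<and> x \<noteq> pi/2"
      using AE_lborel_singleton[of "0::real"] AE_lborel_singleton[of "pi/2"] by eventually_elim auto
    then show "AE x in lborel. ennreal (?f ((sin x)\<^sup>2) * (2 * sin x * cos x) * indicator {0..pi/2} x)
       = 2 * (ennreal (cos x powr s) * indicator {0..pi/2} x)"
    proof eventually_elim
      case (elim x)
      show ?case
      proof (cases "x \<in> {0..pi/2}")
        case True
        then have p: "sin x > 0" "cos x > 0"
          using elim by (auto intro!: sin_gt_zero cos_gt_zero)
        have a: "(sin x)\<^sup>2 powr (-1/2) = 1 / sin x"
          using p square_powr_half[of "sin x" "-1"] by (simp add: powr_minus_divide)
        have "(1 - (sin x)\<^sup>2) powr ((s - 1)/2) = cos x powr (s - 1)"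
          using p by (simp add: cos_squared_eq[symmetric] square_powr_half)
        then have b: "(1 - (sin x)\<^sup>2) powr ((s - 1)/2) * cos x = cos x powr s"
          using p by (simp add: powr_diff)
        have "?f ((sin x)\<^sup>2) * (2 * sin x * cos x) = 2 * cos x powr s"
          using p unfolding a by (simp add: b[symmetric])
        then show ?thesis using True by (simp only: indicator_simps if_True) (simp add: ennreal_mult')
      qed simp
    qed
  qed
  also have "\<dots> = 2 * (\<integral>\<^sup>+x. ennreal (cos x powr s) * indicator {0..pi/2} x \<partial>lborel)"
    by (rule nn_integral_cmult) measurable
  finally have "ennreal (Beta (1/2) ((s+1)/2)) = 2 * (\<integral>\<^sup>+x. ennreal (cos x powr s) * indicator {0..pi/2} x \<partial>lborel)" .
  \<comment> \<open>In \<open>ennreal\<close>, dividing by 2 requires treating the value \<infinity>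
    separately; it is excluded because the left side is finite.\<close>
  then show ?thesis
    using Beta_half_nonneg[OF s] by (cases "\<integral>\<^sup>+x. ennreal (cos x powr s) * indicator {0..pi/2} x \<partial>lborel")
      (auto simp: ennreal_mult'[symmetric] ennreal_mult_top simp flip: ennreal_numeral)
qed

text \<open>This is the mean of |cos x|^s over a period, that is, the moment E|Re w|^s for w uniform
  on the unit circle.\<close>

definition cos_moment :: "real \<Rightarrow> real" where
  "cos_moment s = Gamma ((s + 1)/2) / (sqrt pi * Gamma (1 + s/2))"

lemma cos_moment_pos: "s > 0 \<Longrightarrow> cos_moment s > 0"
  by (auto simp: cos_moment_def intro!: divide_pos_pos mult_pos_pos Gamma_real_pos)

text \<open>All four quarters of the period contribute equally: x \<mapsto> pi - x exchanges the
  first two, and a shift by pi only changes the sign of the cosine.\<close>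

lemma nn_integral_abs_cos:
  assumes s: "s > (0::real)"
  shows "(\<integral>\<^sup>+x. ennreal (\<bar>cos x\<bar> powr s) * indicator {0..<2*pi} x \<partial>lborel) = ennreal (2 * pi * cos_moment s)"
proof -
  let ?G = "\<lambda>x::real. ennreal (\<bar>cos x\<bar> powr s)"
  let ?I = "\<lambda>A. \<integral>\<^sup>+x. ?G x * indicator A x \<partial>lborel"
  let ?b = "Beta (1/2) ((s + 1)/2) / 2"
  have q1: "?I {0..pi/2} = ennreal ?b"
    unfolding nn_integral_cos_quarter[OF s, symmetric]
    by (intro nn_integral_cong) (auto simp: indicator_def cos_ge_zero)
  have "?I {pi/2<..<pi} = ennreal \<bar>-1\<bar> * (\<integral>\<^sup>+x. ?G (pi + (-1) * x) * indicator {pi/2<..<pi} (pi + (-1) * x) \<partial>lborel)"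
    by (rule nn_integral_real_affine) auto
  also have "\<dots> = ?I {0<..<pi/2}"
    by (simp, intro nn_integral_cong) (auto simp: indicator_def)
  also have "\<dots> = ?I {0..pi/2}"
  proof (rule nn_integral_cong_AE)
    show "AE x in lborel. ?G x * indicator {0<..<pi/2} x = ?G x * indicator {0..pi/2} x"
      using AE_lborel_singleton[of "0::real"] AE_lborel_singleton[of "pi/2"]
      by eventually_elim (auto simp: indicator_def)
  qed
  finally have q2: "?I {pi/2<..<pi} = ennreal ?b" using q1 by simp
  have "?I {0..<pi} = (\<integral>\<^sup>+x. ?G x * indicator {0..pi/2} x + ?G x * indicator {pi/2<..<pi} x \<partial>lborel)"
    by (intro nn_integral_cong) (auto simp: indicator_def, use pi_gt_zero in linarith)
  also have "\<dots> = ?I {0..pi/2} + ?I {pi/2<..<pi}"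
    by (rule nn_integral_add) measurable
  finally have h1: "?I {0..<pi} = ennreal ?b + ennreal ?b"
    by (simp add: q1 q2)
  have "?I {pi..<2*pi} = ennreal \<bar>1\<bar> * (\<integral>\<^sup>+x. ?G (pi + 1 * x) * indicator {pi..<2*pi} (pi + 1 * x) \<partial>lborel)"
    by (rule nn_integral_real_affine) auto
  also have "\<dots> = ?I {0..<pi}"
    by (simp, intro nn_integral_cong) (auto simp: indicator_def cos_add)
  finally have h2: "?I {pi..<2*pi} = ?I {0..<pi}" .
  have "?I {0..<2*pi} = (\<integral>\<^sup>+x. ?G x * indicator {0..<pi} x + ?G x * indicator {pi..<2*pi} x \<partial>lborel)"
    by (intro nn_integral_cong) (auto simp: indicator_def)
  also have "\<dots> = ?I {0..<pi} + ?I {pi..<2*pi}"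
    by (rule nn_integral_add) measurable
  finally have "?I {0..<2*pi} = (ennreal ?b + ennreal ?b) + (ennreal ?b + ennreal ?b)"
    by (simp add: h1 h2)
  also have b0: "?b \<ge> 0"
    using Beta_half_nonneg[OF s] by simp
  have "(ennreal ?b + ennreal ?b) + (ennreal ?b + ennreal ?b) = ennreal (4 * ?b)"
    using b0 by (simp flip: ennreal_plus)
  also have "4 * ?b = 2 * pi * cos_moment s"
  proof -
    have "1/2 + (s + 1)/2 = 1 + s/2" by (simp add: field_simps)
    moreover have "Gamma (1 + s/2) \<noteq> 0" using s Gamma_real_pos[of "1 + s/2"] by (metis add_pos_pos half_gt_zero less_irrefl zero_less_one)
    moreover have "pi = sqrt pi * sqrt pi" by simp
    ultimately show ?thesis
      unfolding cos_moment_def Beta_def by (simp add: Gamma_one_half_real field_simps)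
  qed
  finally show ?thesis .
qed

text \<open>Substitute t = x^2/2 in the Euler integral of Gamma ((s + 1)/2).\<close>

lemma nn_integral_half_gaussian:
  assumes s: "s > (0::real)"
  shows "(\<integral>\<^sup>+x. ennreal (x powr s * exp (- x\<^sup>2/2)) * indicator {0<..} x \<partial>lborel)
     = ennreal (2 powr ((s - 1)/2) * Gamma ((s + 1)/2))"
proof -
  let ?f = "\<lambda>t::real. t powr ((s + 1)/2 - 1) / exp t"
  have "(?f has_integral Gamma ((s + 1)/2)) {0..}"
    using s by (intro Gamma_integral_real) auto
  then have f: "(?f has_integral Gamma ((s + 1)/2)) {0<..}"
    by (rule has_integral_spike_set_eq[THEN iffD1, rotated 2]) (auto intro: negligible_subset[of "{0}"])
  then have "?f absolutely_integrable_on {0<..}"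
    by (intro nonnegative_absolutely_integrable_1) (auto intro: has_integral_integrable)
  moreover have im: "(\<lambda>x::real. x\<^sup>2/2) ` {0<..} = {0<..}"
  proof (intro equalityI subsetI)
    fix y :: real assume "y \<in> {0<..}"
    then show "y \<in> (\<lambda>x::real. x\<^sup>2/2) ` {0<..}"
      by (intro image_eqI[of _ _ "sqrt (2 * y)"]) auto
  qed auto
  ultimately have "(\<lambda>x. \<bar>x\<bar> * ?f (x\<^sup>2/2)) absolutely_integrable_on {0<..} \<and>
      integral {0<..} (\<lambda>x. \<bar>x\<bar> * ?f (x\<^sup>2/2)) = Gamma ((s + 1)/2)"
    using f integral_unique[OF f]
    by (subst has_absolute_integral_change_of_variables_1'[where g = "\<lambda>x. x\<^sup>2/2" and g' = "\<lambda>x. x"])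
       (auto intro!: derivative_eq_intros inj_onI)
  then have "((\<lambda>x. \<bar>x\<bar> * ?f (x\<^sup>2/2)) has_integral Gamma ((s + 1)/2)) {0<..}"
    unfolding has_integral_iff absolutely_integrable_on_def by blast
  then have "((\<lambda>x. 2 powr ((s - 1)/2) * (\<bar>x\<bar> * ?f (x\<^sup>2/2))) has_integral 2 powr ((s - 1)/2) * Gamma ((s + 1)/2)) {0<..}"
    by (rule has_integral_mult_right)
  then have h: "((\<lambda>x. x powr s * exp (- x\<^sup>2/2)) has_integral 2 powr ((s - 1)/2) * Gamma ((s + 1)/2)) {0<..}"
  proof (rule has_integral_eq[rotated])
    fix x :: real assume "x \<in> {0<..}"
    then have x: "x > 0" by simp
    have e: "(s + 1)/2 - 1 = (s - 1)/2" by (simp add: field_simps)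
    have "(x\<^sup>2/2) powr ((s - 1)/2) = x powr (s - 1) / 2 powr ((s - 1)/2)"
      using x by (simp add: powr_divide square_powr_half)
    also have "x powr (s - 1) = x powr s / x"
      using x by (simp add: powr_diff)
    finally have "(x\<^sup>2/2) powr ((s - 1)/2) = x powr s / x / 2 powr ((s - 1)/2)" .
    then show "2 powr ((s - 1)/2) * (\<bar>x\<bar> * ?f (x\<^sup>2/2)) = x powr s * exp (- x\<^sup>2/2)"
      using x unfolding e by (simp add: exp_minus field_simps)
  qed
  show ?thesis
    using nn_integral_has_integral_lebesgue[OF _ h]
    by (simp add: mult.commute ennreal_mult' ennreal_indicator)
qed

text \<open>The right side is not simplified on purpose. A standard normal variable is sqrt 2 * Re Z
  for a standard complex Gaussian Z, whose phase is uniform and independent of |Z|; so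
  \<open>cos_moment s\<close> is the share of the phase and Gamma (1 + s/2) that of |Z|.\<close>

lemma nn_integral_std_normal_abs_powr:
  assumes s: "s > (0::real)"
  shows "(\<integral>\<^sup>+x. ennreal (\<bar>x\<bar> powr s) \<partial>std_normal_distribution)
     = ennreal (2 powr (s/2) * (cos_moment s * Gamma (1 + s/2)))"
proof -
  let ?h = "\<lambda>x::real. ennreal (\<bar>x\<bar> powr s * exp (- x\<^sup>2/2))"
  let ?J = "2 powr ((s - 1)/2) * Gamma ((s + 1)/2)"
  have J0: "?J \<ge> 0" using s by (intro mult_nonneg_nonneg Gamma_real_nonneg) auto
  have r: "(\<integral>\<^sup>+x. ?h x * indicator {0<..} x \<partial>lborel) = ennreal ?J"
    unfolding nn_integral_half_gaussian[OF s, symmetric]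
    by (intro nn_integral_cong) (auto simp: indicator_def)
  have "(\<integral>\<^sup>+x. ?h x * indicator {..<0} x \<partial>lborel)
     = ennreal \<bar>-1\<bar> * (\<integral>\<^sup>+x. ?h (0 + (-1) * x) * indicator {..<0} (0 + (-1) * x) \<partial>lborel)"
    by (rule nn_integral_real_affine) auto
  also have "\<dots> = (\<integral>\<^sup>+x. ?h x * indicator {0<..} x \<partial>lborel)"
    by (simp, intro nn_integral_cong) (auto simp: indicator_def)
  finally have l: "(\<integral>\<^sup>+x. ?h x * indicator {..<0} x \<partial>lborel) = ennreal ?J"
    using r by simp
  \<comment> \<open>The point 0 can be left out because \<open>0 powr s = 0\<close>.\<close>
  have "(\<integral>\<^sup>+x. ?h x \<partial>lborel) = (\<integral>\<^sup>+x. ?h x * indicator {..<0} x + ?h x * indicator {0<..} x \<partial>lborel)"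
    using s by (intro nn_integral_cong) (auto simp: indicator_def)
  also have "\<dots> = (\<integral>\<^sup>+x. ?h x * indicator {..<0} x \<partial>lborel) + (\<integral>\<^sup>+x. ?h x * indicator {0<..} x \<partial>lborel)"
    by (rule nn_integral_add) measurable
  also have "\<dots> = ennreal ?J + ennreal ?J"
    by (simp only: l r)
  also have "\<dots> = ennreal (2 * ?J)"
    using J0 by (simp add: mult.commute flip: ennreal_plus)
  finally have tot: "(\<integral>\<^sup>+x. ?h x \<partial>lborel) = ennreal (2 * ?J)" .
  have "(\<integral>\<^sup>+x. ennreal (\<bar>x\<bar> powr s) \<partial>std_normal_distribution)
      = (\<integral>\<^sup>+x. ennreal (std_normal_density x) * ennreal (\<bar>x\<bar> powr s) \<partial>lborel)"
    by (subst nn_integral_density) auto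
  also have "\<dots> = (\<integral>\<^sup>+x. ennreal (1 / sqrt (2 * pi)) * ?h x \<partial>lborel)"
    by (intro nn_integral_cong) (simp add: std_normal_density_def ennreal_mult'[symmetric] mult_ac)
  also have "\<dots> = ennreal (1 / sqrt (2 * pi)) * (\<integral>\<^sup>+x. ?h x \<partial>lborel)"
    by (rule nn_integral_cmult) measurable
  also have "\<dots> = ennreal (1 / sqrt (2 * pi)) * ennreal (2 * ?J)"
    by (simp only: tot)
  also have "\<dots> = ennreal (1 / sqrt (2 * pi) * (2 * ?J))"
    by (rule ennreal_mult'[symmetric]) simp
  also have "1 / sqrt (2 * pi) * (2 * ?J) = 2 powr (s/2) * (cos_moment s * Gamma (1 + s/2))"
  proof -
    have g: "Gamma (1 + s/2) \<noteq> 0" using s Gamma_real_pos[of "1 + s/2"] by (metis add_pos_pos half_gt_zero less_irrefl zero_less_one)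
    have "2 powr ((s - 1)/2) = 2 powr (s/2) / (2 powr (1/2) :: real)"
      by (simp add: powr_diff[symmetric] diff_divide_distrib)
    also have "2 powr (1/2) = sqrt (2::real)" by (simp add: powr_half_sqrt)
    finally have e: "2 powr ((s - 1)/2) = 2 powr (s/2) / sqrt 2" .
    have "sqrt 2 * sqrt 2 = (2::real)" by simp
    then show ?thesis
      unfolding e cos_moment_def real_sqrt_mult using g by (simp add: field_simps)
  qed
  finally show ?thesis .
qed

section \<open>Normalised sums of independent Steinhaus variables\<close>

lemma nn_integral_circle_abs_Re:
  assumes "s > 0"
  shows "(\<integral>\<^sup>+w. ennreal (\<bar>Re w\<bar> powr s) \<partial>circle_measure) = ennreal (cos_moment s)"
proof -
  have "ennreal (2 * pi * cos_moment s) / ennreal (2 * pi) = ennreal (cos_moment s)"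
    using cos_moment_pos[OF assms] by (subst divide_ennreal) auto
  then show ?thesis
    by (simp add: nn_integral_circle_measure nn_integral_abs_cos[OF assms])
qed

text \<open>The modulus of c factors out, and its phase \<open>sgn c\<close> is absorbed by rotation
  invariance.\<close>

lemma nn_integral_circle_abs_Re_mult:
  assumes s: "s > 0"
  shows "(\<integral>\<^sup>+w. ennreal (\<bar>Re (w * c)\<bar> powr s) \<partial>circle_measure) = ennreal (cos_moment s * cmod c powr s)"
proof (cases "c = 0")
  case False
  let ?F = "\<lambda>w. ennreal (\<bar>Re w\<bar> powr s) * ennreal (cmod c powr s)"
  have "ennreal (\<bar>Re (w * c)\<bar> powr s) = ?F (sgn c * w)" for w
  proof -
    have "w * c = of_real (cmod c) * (sgn c * w)"
      using False by (simp add: sgn_eq mult_ac)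
    then have "\<bar>Re (w * c)\<bar> = cmod c * \<bar>Re (sgn c * w)\<bar>"
      by (simp only: Re_complex_of_real times_complex.sel Im_complex_of_real) (simp add: abs_mult)
    then show ?thesis by (simp add: powr_mult ennreal_mult' mult.commute)
  qed
  then have "(\<integral>\<^sup>+w. ennreal (\<bar>Re (w * c)\<bar> powr s) \<partial>circle_measure) = (\<integral>\<^sup>+w. ?F (sgn c * w) \<partial>circle_measure)"
    by simp
  also have "\<dots> = (\<integral>\<^sup>+w. ?F w \<partial>circle_measure)"
    using False by (intro nn_integral_circle_measure_rotate) (auto simp: norm_sgn)
  also have "\<dots> = ennreal (cos_moment s) * ennreal (cmod c powr s)"
    by (subst nn_integral_multc)
       (auto intro!: borel_measurable_circle_measure simp: nn_integral_circle_abs_Re[OF s])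
  finally show ?thesis
    using cos_moment_pos[OF s] by (simp add: ennreal_mult')
qed (use s in simp)

text \<open>Rotating all coordinates by one uniform w changes nothing after integration over z.
  Exchanging the integrals and integrating over w first then replaces |Re (w * S z)|^s by its mean
  over the phase.\<close>

lemma nn_integral_abs_Re_rotation_invariant:
  assumes s: "s > 0"
    and S[measurable]: "S \<in> borel_measurable torus_measure"
    and hom: "\<And>w z. S (\<lambda>j. w * z j) = w * S z"
  shows "(\<integral>\<^sup>+z. ennreal (\<bar>Re (S z)\<bar> powr s) \<partial>torus_measure)
       = ennreal (cos_moment s) * (\<integral>\<^sup>+z. ennreal (cmod (S z) powr s) \<partial>torus_measure)"
proof -
  interpret T: prob_space torus_measure by (rule prob_space_torus_measure)
  interpret C: prob_space circle_measure by (rule prob_space_circle_measure)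
  interpret P: pair_sigma_finite circle_measure torus_measure ..
  have id[measurable]: "(\<lambda>w. w) \<in> borel_measurable circle_measure"
    by (rule borel_measurable_circle_measure) simp
  have "(\<integral>\<^sup>+z. ennreal (\<bar>Re (S z)\<bar> powr s) \<partial>torus_measure)
      = (\<integral>\<^sup>+w. (\<integral>\<^sup>+z. ennreal (\<bar>Re (S z)\<bar> powr s) \<partial>torus_measure) \<partial>circle_measure)"
    by (simp add: C.emeasure_space_1)
  also have "\<dots> = (\<integral>\<^sup>+w. (\<integral>\<^sup>+z. ennreal (\<bar>Re (w * S z)\<bar> powr s) \<partial>torus_measure) \<partial>circle_measure)"
  proof (rule nn_integral_cong)
    fix w assume "w \<in> space circle_measure"
    then have w: "cmod w = 1" by (simp add: space_circle_measure)
    show "(\<integral>\<^sup>+z. ennreal (\<bar>Re (S z)\<bar> powr s) \<partial>torus_measure)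
        = (\<integral>\<^sup>+z. ennreal (\<bar>Re (w * S z)\<bar> powr s) \<partial>torus_measure)"
      unfolding hom[symmetric]
      by (rule nn_integral_torus_rotate[OF _ w, symmetric]) measurable
  qed
  also have "\<dots> = (\<integral>\<^sup>+z. (\<integral>\<^sup>+w. ennreal (\<bar>Re (w * S z)\<bar> powr s) \<partial>circle_measure) \<partial>torus_measure)"
    by (rule P.Fubini'[symmetric]) measurable
  also have "\<dots> = (\<integral>\<^sup>+z. ennreal (cos_moment s) * ennreal (cmod (S z) powr s) \<partial>torus_measure)"
    using cos_moment_pos[OF s]
    by (simp only: nn_integral_circle_abs_Re_mult[OF s] ennreal_mult' powr_ge_zero)
  also have "\<dots> = ennreal (cos_moment s) * (\<integral>\<^sup>+z. ennreal (cmod (S z) powr s) \<partial>torus_measure)"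
    by (rule nn_integral_cmult) measurable
  finally show ?thesis .
qed

definition steinhaus_sum :: "nat \<Rightarrow> (nat \<Rightarrow> complex) \<Rightarrow> complex" where
  "steinhaus_sum n z = (\<Sum>j<n. z j) / of_real (sqrt (real n))"

lemma measurable_steinhaus_sum [measurable]: "steinhaus_sum n \<in> borel_measurable torus_measure"
  unfolding steinhaus_sum_def by measurable

lemma steinhaus_sum_mult: "steinhaus_sum n (\<lambda>j. w * z j) = w * steinhaus_sum n z"
  by (simp add: steinhaus_sum_def sum_distrib_left)

text \<open>This is the variance of Re z_j, the reason for the factor sqrt 2 in the central limit
  theorem below.\<close>

lemma cos_moment_2: "cos_moment 2 = 1/2"
proof -
  have "Gamma (3/2 :: real) = 1/2 * Gamma (1/2)"
    using Gamma_plus1[of "1/2::real"] nonpos_Ints_nonpos[of "1/2::real"] by auto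
  then show ?thesis
    using Gamma_fact[of 1, where 'a=real] by (simp add: cos_moment_def Gamma_one_half_real)
qed

text \<open>The variables Re z_j are independent and identically distributed with mean 0 and
  variance 1/2, so the classical central limit theorem applies.\<close>

lemma weak_conv_steinhaus_sum:
  "weak_conv_m (\<lambda>n. distr torus_measure borel (\<lambda>z. sqrt 2 * Re (steinhaus_sum n z))) std_normal_distribution"
proof -
  interpret T: prob_space torus_measure by (rule prob_space_torus_measure)
  let ?X = "\<lambda>j z. Re (z j) :: real"
  have hom: "(\<lambda>z. z j) (\<lambda>j. w * z j) = w * (\<lambda>z. z j) z" for j and w :: complex and z
    by simp
  have sq: "(\<integral>\<^sup>+z. ennreal ((?X j z)\<^sup>2) \<partial>torus_measure) = ennreal (1/2)" for j
  proof -
    have "(\<integral>\<^sup>+z. ennreal ((?X j z)\<^sup>2) \<partial>torus_measure) = (\<integral>\<^sup>+z. ennreal (\<bar>?X j z\<bar> powr 2) \<partial>torus_measure)"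
      by (intro nn_integral_cong) simp
    also have "\<dots> = ennreal (cos_moment 2) * (\<integral>\<^sup>+z. ennreal (cmod (z j) powr 2) \<partial>torus_measure)"
      by (rule nn_integral_abs_Re_rotation_invariant) auto
    also have "(\<integral>\<^sup>+z. ennreal (cmod (z j) powr 2) \<partial>torus_measure) = (\<integral>\<^sup>+z. 1 \<partial>torus_measure)"
      by (intro nn_integral_cong) (simp add: space_torus_measure)
    finally show ?thesis by (simp add: T.emeasure_space_1 cos_moment_2)
  qed
  have int: "integrable torus_measure (\<lambda>z. (?X j z)\<^sup>2)" for j
  proof (rule integrableI_nonneg)
    show "(\<integral>\<^sup>+z. ennreal ((?X j z)\<^sup>2) \<partial>torus_measure) < \<infinity>"
      unfolding sq by (simp only: ennreal_less_top infinity_ennreal_def)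
  qed simp_all
  have sq': "T.expectation (\<lambda>z. (?X j z)\<^sup>2) = 1/2" for j
  proof -
    have "T.expectation (\<lambda>z. (?X j z)\<^sup>2) = enn2real (\<integral>\<^sup>+z. ennreal ((?X j z)\<^sup>2) \<partial>torus_measure)"
      by (rule integral_eq_nn_integral) auto
    also have "\<dots> = 1/2"
      unfolding sq by (rule enn2real_ennreal) simp
    finally show ?thesis .
  qed
  have mean: "T.expectation (?X j) = 0" for j
  proof -
    have "integrable torus_measure (\<lambda>z. z j)"
      by (rule T.integrable_const_bound[of _ 1]) (auto simp: space_torus_measure)
    \<comment> \<open>Rotation by -1 shows that the mean equals its own negative.\<close>
    moreover have "(\<integral>z. z j \<partial>torus_measure) = (\<integral>z. - z j \<partial>torus_measure)"
      using integral_torus_rotate[of "\<lambda>z. z j" "\<lambda>_. -1"] by simp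
    ultimately show ?thesis by (simp add: complex_eq_iff)
  qed
  have indep: "T.indep_vars (\<lambda>_. borel) ?X UNIV"
    by (rule T.indep_vars_compose2[OF indep_vars_torus_component])
       (auto intro: borel_measurable_circle_measure)
  have distr: "distr torus_measure borel (?X j) = distr torus_measure borel (?X 0)" for j
  proof -
    \<comment> \<open>The shift i \<mapsto> i + j preserves the Haar measure and turns coordinate 0
      into coordinate j.\<close>
    have "distr torus_measure borel (?X j) = distr (distr torus_measure torus_measure
        (\<lambda>z i. z (i + j))) borel (?X 0)"
      by (subst distr_distr) (auto simp: measurable_torus_reindex comp_def)
    also have "\<dots> = distr torus_measure borel (?X 0)"
      by (subst distr_torus_reindex) auto
    finally show ?thesis .
  qed
  have "weak_conv_m (\<lambda>n. distr torus_measure borel (\<lambda>z. (\<Sum>i<n. ?X i z) / sqrt (n * (sqrt (1/2))\<^sup>2))) std_normal_distribution"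
    by (rule T.central_limit_theorem_zero_mean[OF indep mean _ int _ distr])
       (simp_all add: mean sq')
  also have "(\<lambda>n z. (\<Sum>i<n. ?X i z) / sqrt (real n * (sqrt (1/2))\<^sup>2)) = (\<lambda>n z. sqrt 2 * Re (steinhaus_sum n z))"
    by (intro ext) (simp add: steinhaus_sum_def real_sqrt_mult real_sqrt_divide field_simps Re_sum del: of_real_sqrt)
  finally show ?thesis .
qed

text \<open>Weak convergence controls only bounded continuous test functions. By monotone
  convergence, a strict lower bound for an integral is already attained by a bounded
  truncation.\<close>

lemma ex_truncated_integral_gt:
  fixes f :: "'a \<Rightarrow> real"
  assumes [measurable]: "f \<in> borel_measurable M" and "prob_space M" and f: "\<And>x. 0 \<le> f x"
    and c: "ennreal c < (\<integral>\<^sup>+x. ennreal (f x) \<partial>M)"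
  shows "\<exists>m::nat. c < (\<integral>x. min (f x) (real m) \<partial>M)"
proof -
  interpret prob_space M by fact
  have "(\<lambda>m. (\<integral>\<^sup>+x. ennreal (min (f x) (real m)) \<partial>M)) \<longlonglongrightarrow> (\<integral>\<^sup>+x. ennreal (f x) \<partial>M)"
  proof (rule nn_integral_LIMSEQ)
    show "incseq (\<lambda>m x. ennreal (min (f x) (real m)))"
      by (auto simp: incseq_def le_fun_def intro!: ennreal_leI)
    fix x
    have "\<forall>\<^sub>F m in sequentially. min (f x) (real m) = f x"
      using eventually_ge_at_top[of "nat \<lceil>f x\<rceil>"] by eventually_elim (simp add: min_def nat_ceiling_le_eq)
    then show "(\<lambda>m. ennreal (min (f x) (real m))) \<longlonglongrightarrow> ennreal (f x)"
      by (intro tendsto_eventually) (auto elim: eventually_mono)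
  qed measurable
  from order_tendstoD(1)[OF this c]
  obtain m where m: "ennreal c < (\<integral>\<^sup>+x. ennreal (min (f x) (real m)) \<partial>M)"
    by (auto simp: eventually_sequentially)
  have "(\<integral>\<^sup>+x. ennreal (min (f x) (real m)) \<partial>M) = ennreal (\<integral>x. min (f x) (real m) \<partial>M)"
    using f by (intro nn_integral_eq_integral integrable_const_bound[of _ "real m"]) auto
  with m show ?thesis
    by (auto simp: ennreal_less_iff dest: ennreal_lessI intro!: exI[of _ m] simp del: ennreal_less_iff)
      (metis ennreal_leI linorder_not_less)
qed

text \<open>Only the lower half of the convergence of moments enters the norm quotient, and
  truncation followed by weak convergence yields exactly that half.\<close>

lemma steinhaus_moment_liminf:
  assumes s: "s > 0" and c: "0 \<le> c" "c < Gamma (1 + s/2)"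
  shows "\<forall>\<^sub>F n in sequentially. ennreal c < (\<integral>\<^sup>+z. ennreal (cmod (steinhaus_sum n z) powr s) \<partial>torus_measure)"
proof -
  interpret T: prob_space torus_measure by (rule prob_space_torus_measure)
  let ?\<mu> = "\<lambda>n. distr torus_measure borel (\<lambda>z. sqrt 2 * Re (steinhaus_sum n z))"
  interpret \<mu>: real_distribution "?\<mu> n" for n
    by (intro T.real_distribution_distr) measurable
  \<comment> \<open>\<open>K\<close> is the common factor relating E|sqrt 2 * Re S|^s to E|S|^s and
    the normal moment to Gamma (1 + s/2). It cancels at the end.\<close>
  define K where "K = 2 powr (s/2) * cos_moment s"
  have K: "K > 0" using cos_moment_pos[OF s] by (simp add: K_def)
  have "ennreal (K * c) < (\<integral>\<^sup>+x. ennreal (\<bar>x\<bar> powr s) \<partial>std_normal_distribution)"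
    unfolding nn_integral_std_normal_abs_powr[OF s] mult.assoc[symmetric] K_def[symmetric]
    using K c by (intro ennreal_lessI) auto
  from ex_truncated_integral_gt[OF _ prob_space_normal_density _ this]
  obtain m :: nat where m: "K * c < (\<integral>x. min (\<bar>x\<bar> powr s) (real m) \<partial>std_normal_distribution)"
    by auto
  have "(\<lambda>n. integral\<^sup>L (?\<mu> n) (\<lambda>x. min (\<bar>x\<bar> powr s) (real m))) \<longlonglongrightarrow>
      integral\<^sup>L std_normal_distribution (\<lambda>x. min (\<bar>x\<bar> powr s) (real m))"
  proof (rule weak_conv_imp_integral_bdd_continuous_conv[where B="real m"])
    have "continuous_on UNIV (\<lambda>x::real. min (\<bar>x\<bar> powr s) (real m))"
      using s by (intro continuous_intros continuous_on_powr') auto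
    then show "isCont (\<lambda>x. min (\<bar>x\<bar> powr s) (real m)) x" for x :: real
      by (simp add: continuous_on_eq_continuous_at)
  qed (auto intro: weak_conv_steinhaus_sum real_dist_normal_dist \<mu>.real_distribution_axioms)
  from order_tendstoD(1)[OF this m]
  show ?thesis
  proof eventually_elim
    case (elim n)
    let ?Y = "\<lambda>z. ennreal (cmod (steinhaus_sum n z) powr s)"
    have "ennreal (K * c) < ennreal (integral\<^sup>L (?\<mu> n) (\<lambda>x. min (\<bar>x\<bar> powr s) (real m)))"
      using elim K c by (subst ennreal_less_iff) auto
    also have "\<dots> = (\<integral>\<^sup>+x. ennreal (min (\<bar>x\<bar> powr s) (real m)) \<partial>?\<mu> n)"
      by (intro nn_integral_eq_integral[symmetric] \<mu>.integrable_const_bound[of _ "real m"]) auto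
    also have "\<dots> \<le> (\<integral>\<^sup>+x. ennreal (\<bar>x\<bar> powr s) \<partial>?\<mu> n)"
      by (intro nn_integral_mono) auto
    also have "\<dots> = (\<integral>\<^sup>+z. ennreal (2 powr (s/2)) * ennreal (\<bar>Re (steinhaus_sum n z)\<bar> powr s) \<partial>torus_measure)"
      by (subst nn_integral_distr)
         (auto simp: abs_mult powr_mult ennreal_mult' powr_half_sqrt[symmetric] powr_powr)
    also have "\<dots> = ennreal (2 powr (s/2)) * (\<integral>\<^sup>+z. ennreal (\<bar>Re (steinhaus_sum n z)\<bar> powr s) \<partial>torus_measure)"
      by (rule nn_integral_cmult) measurable
    also have "\<dots> = ennreal (2 powr (s/2)) * (ennreal (cos_moment s) * integral\<^sup>N torus_measure ?Y)"
      by (subst nn_integral_abs_Re_rotation_invariant[OF s _ steinhaus_sum_mult]) auto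
    also have "\<dots> = ennreal K * integral\<^sup>N torus_measure ?Y"
      by (simp add: K_def ennreal_mult' mult.assoc)
    finally have "ennreal K * ennreal c < ennreal K * integral\<^sup>N torus_measure ?Y"
      using K c by (simp add: ennreal_mult')
    then show ?case
      by (meson linorder_not_less mult_left_mono zero_le)
  qed
qed

section \<open>Fourier coefficients and the Riesz projection\<close>

lemma monomial_mult: "monomial \<alpha> (\<lambda>j. w j * z j) = monomial \<alpha> w * monomial \<alpha> z"
  by (simp add: monomial_def power_int_mult_distrib prod.distrib)

lemma measurable_power_int [measurable]:
  fixes f :: "'a \<Rightarrow> complex"
  assumes [measurable]: "f \<in> borel_measurable M"
  shows "(\<lambda>x. f x powi m) \<in> borel_measurable M"
  unfolding power_int_def by (cases "m \<ge> 0") (simp_all del: power_inverse)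

lemma measurable_monomial [measurable]: "monomial \<alpha> \<in> borel_measurable torus_measure"
  unfolding monomial_def by measurable

lemma measurable_cnj [measurable]: "cnj \<in> borel_measurable borel"
  by (intro borel_measurable_continuous_onI continuous_intros)

lemma ex_unit_power_int_neq:
  assumes "a \<noteq> (b::int)"
  shows "\<exists>u. cmod u = 1 \<and> u powi a * cnj (u powi b) \<noteq> 1"
proof -
  \<comment> \<open>Chosen so that \<open>?u powi (a - b)\<close> is cis pi = -1.\<close>
  let ?u = "cis (pi / real_of_int (a - b))"
  have "of_int a * x + - (of_int b * x) = of_int (a - b) * x" for x :: real
    by (simp add: algebra_simps)
  then have "?u powi a * cnj (?u powi b) = cis (real_of_int (a - b) * (pi / real_of_int (a - b)))"
    by (simp only: cis_power_int cis_cnj cis_mult)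
  also have "\<dots> = -1"
    using assms by simp
  finally show ?thesis
    by (intro exI[of _ ?u]) simp
qed

text \<open>Rotating the coordinates in B by u preserves the integral, while the integrand is
  multiplied by u^(a - d), where d is the degree of \<alpha> in B. If d differs from a, some u makes
  this factor different from 1, and the coefficient must vanish.\<close>

lemma fourier_coeff_rotation:
  fixes B :: "nat set" and a :: int
  assumes [measurable]: "f \<in> borel_measurable torus_measure" and \<alpha>: "\<alpha> \<in> Z0_inf"
    and hom: "\<And>u z. cmod u = 1 \<Longrightarrow> f (\<lambda>j. (if j \<in> B then u else 1) * z j) = u powi a * f z"
    and nz: "fourier_coeff f \<alpha> \<noteq> 0"
  shows "(\<Sum>j | \<alpha> j \<noteq> 0 \<and> j \<in> B. \<alpha> j) = a"
proof (rule ccontr)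
  define d where "d = (\<Sum>j | \<alpha> j \<noteq> 0 \<and> j \<in> B. \<alpha> j)"
  assume "(\<Sum>j | \<alpha> j \<noteq> 0 \<and> j \<in> B. \<alpha> j) \<noteq> a"
  then have "a \<noteq> d" by (simp add: d_def)
  then obtain u where u: "cmod u = 1" "u powi a * cnj (u powi d) \<noteq> 1"
    using ex_unit_power_int_neq by blast
  have u0: "u \<noteq> 0" using u by auto
  have fin: "finite {j. \<alpha> j \<noteq> 0}" using \<alpha> by (simp add: Z0_inf_def)
  let ?w = "\<lambda>j. if j \<in> B then u else 1"
  have "monomial \<alpha> ?w = (\<Prod>j | \<alpha> j \<noteq> 0 \<and> j \<in> B. u powi \<alpha> j)"
    unfolding monomial_def using fin
    by (intro prod.mono_neutral_cong_right) auto
  also have "\<dots> = u powi d"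
  proof -
    have "(\<Prod>j\<in>X. u powi \<alpha> j) = u powi (\<Sum>j\<in>X. \<alpha> j)" if "finite X" for X
      using that by induction (auto simp: power_int_add u0)
    then show ?thesis using fin by (simp add: d_def)
  qed
  finally have mono: "monomial \<alpha> ?w = u powi d" .
  have "fourier_coeff f \<alpha> = (\<integral>z. f (\<lambda>j. ?w j * z j) * cnj (monomial \<alpha> (\<lambda>j. ?w j * z j)) \<partial>torus_measure)"
    unfolding fourier_coeff_def
    by (rule integral_torus_rotate[where F = "\<lambda>z. f z * cnj (monomial \<alpha> z)", symmetric]) (auto simp: u)
  also have "\<dots> = (\<integral>z. (u powi a * cnj (u powi d)) * (f z * cnj (monomial \<alpha> z)) \<partial>torus_measure)"
    by (intro Bochner_Integration.integral_cong refl)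
       (simp only: hom[OF u(1)] monomial_mult mono complex_cnj_mult, simp only: mult_ac)
  also have "\<dots> = (u powi a * cnj (u powi d)) * fourier_coeff f \<alpha>"
    unfolding fourier_coeff_def by (rule integral_mult_right_zero)
  finally show False using u nz by simp
qed

section \<open>Products over independent blocks of variables\<close>

definition block_sum :: "nat \<Rightarrow> nat \<Rightarrow> (nat \<Rightarrow> complex) \<Rightarrow> complex" where
  "block_sum n i z = steinhaus_sum n (\<lambda>j. z (i * n + j))"

lemma measurable_block_sum [measurable]: "block_sum n i \<in> borel_measurable torus_measure"
  unfolding block_sum_def
  by (rule measurable_compose[OF measurable_torus_reindex measurable_steinhaus_sum])

text \<open>The blocks use disjoint sets of independent coordinates, so the integral of the product
  factors; each factor is reduced to the first block by a shift of indices.\<close>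

lemma nn_integral_prod_block_sum:
  fixes \<phi> :: "complex \<Rightarrow> ennreal"
  assumes [measurable]: "\<phi> \<in> borel_measurable borel"
  shows "(\<integral>\<^sup>+z. (\<Prod>i<k. \<phi> (block_sum n i z)) \<partial>torus_measure)
       = (\<integral>\<^sup>+z. \<phi> (steinhaus_sum n z) \<partial>torus_measure) ^ k"
proof -
  interpret T: prob_space torus_measure by (rule prob_space_torus_measure)
  let ?K = "\<lambda>i. {i * n..<i * n + n}"
  have dis: "disjoint_family_on ?K {..<k}"
  proof -
    have "j div n = i" if "j \<in> ?K i" for i j
      using that by (intro div_nat_eqI) (auto simp: mult.commute)
    then show ?thesis unfolding disjoint_family_on_def by blast
  qed
  have 1: "T.indep_vars (\<lambda>i. PiM (?K i) (\<lambda>_. circle_measure)) (\<lambda>i z. restrict (\<lambda>j. z j) (?K i)) {..<k}"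
    by (rule T.indep_vars_restrict[OF indep_vars_torus_component _ dis]) auto
  have "T.indep_vars (\<lambda>_. borel) (\<lambda>i z. \<phi> (steinhaus_sum n (\<lambda>j. restrict (\<lambda>j. z j) (?K i) (i * n + j)))) {..<k}"
  proof (rule T.indep_vars_compose2[OF 1, where Y = "\<lambda>i x. \<phi> (steinhaus_sum n (\<lambda>j. x (i * n + j)))"])
    fix i
    have "(\<lambda>x. x (i * n + j)) \<in> borel_measurable (PiM (?K i) (\<lambda>_. circle_measure))" if "j < n" for j
      using that borel_measurable_circle_measure[of "\<lambda>w. w"]
      by (intro measurable_compose[OF measurable_component_singleton]) auto
    then have "(\<lambda>x. steinhaus_sum n (\<lambda>j. x (i * n + j))) \<in> borel_measurable (PiM (?K i) (\<lambda>_. circle_measure))"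
      unfolding steinhaus_sum_def by (intro borel_measurable_divide borel_measurable_sum) auto
    then show "(\<lambda>x. \<phi> (steinhaus_sum n (\<lambda>j. x (i * n + j)))) \<in> borel_measurable (PiM (?K i) (\<lambda>_. circle_measure))"
      by measurable
  qed
  \<comment> \<open>The restriction is invisible because only indices i * n + j with j < n are
    evaluated, and these lie in block i.\<close>
  also have "(\<lambda>i z. \<phi> (steinhaus_sum n (\<lambda>j. restrict (\<lambda>j. z j) (?K i) (i * n + j)))) = (\<lambda>i z. \<phi> (block_sum n i z))"
    by (intro ext) (simp add: block_sum_def steinhaus_sum_def)
  finally have "(\<integral>\<^sup>+z. (\<Prod>i<k. \<phi> (block_sum n i z)) \<partial>torus_measure)
     = (\<Prod>i<k. \<integral>\<^sup>+z. \<phi> (block_sum n i z) \<partial>torus_measure)"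
    by (intro T.indep_vars_nn_integral) auto
  also have "\<dots> = (\<Prod>i<k. \<integral>\<^sup>+z. \<phi> (steinhaus_sum n z) \<partial>torus_measure)"
  proof (rule prod.cong[OF refl])
    fix i
    show "(\<integral>\<^sup>+z. \<phi> (block_sum n i z) \<partial>torus_measure) = (\<integral>\<^sup>+z. \<phi> (steinhaus_sum n z) \<partial>torus_measure)"
      unfolding block_sum_def
      by (rule nn_integral_torus_reindex[where F = "\<lambda>z. \<phi> (steinhaus_sum n z)"]) (auto intro: injI)
  qed
  finally show ?thesis by simp
qed

lemma norm_steinhaus_sum_le:
  assumes "z \<in> space torus_measure"
  shows "cmod (steinhaus_sum n z) \<le> sqrt n"
proof -
  have "cmod (\<Sum>j<n. z j) \<le> (\<Sum>j<n. cmod (z j))" by (rule norm_sum)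
  also have "\<dots> = n" using assms by (simp add: space_torus_measure)
  finally show ?thesis
    by (simp add: steinhaus_sum_def norm_divide divide_le_eq)
qed

lemma norm_block_sum_le:
  "z \<in> space torus_measure \<Longrightarrow> cmod (block_sum n i z) \<le> sqrt n"
  unfolding block_sum_def by (rule norm_steinhaus_sum_le) (auto simp: space_torus_measure)

section \<open>Frequencies of the expanded product\<close>

text \<open>Multiplying out the product of k block sums means choosing one coordinate, with offset
  \<sigma> i, from each block i < k; this is the exponent of the resulting monomial.\<close>

definition block_exponent :: "nat \<Rightarrow> nat \<Rightarrow> (nat \<Rightarrow> nat) \<Rightarrow> nat \<Rightarrow> int" where
  "block_exponent n k \<sigma> j = (if \<exists>i<k. j = i * n + \<sigma> i then 1 else 0)"

abbreviation block_choices :: "nat \<Rightarrow> nat \<Rightarrow> (nat \<Rightarrow> nat) set" where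
  "block_choices n k \<equiv> PiE {..<k} (\<lambda>_. {..<n})"

lemma block_index_eq_iff:
  fixes a b n :: nat
  assumes "a < n" "b < n"
  shows "i * n + a = i' * n + b \<longleftrightarrow> i = i' \<and> a = b"
proof
  assume eq: "i * n + a = i' * n + b"
  have "(i * n + a) div n = i" "(i' * n + b) div n = i'" using assms by simp_all
  with eq show "i = i' \<and> a = b" by simp
qed simp

lemma monomial_block_exponent:
  assumes \<sigma>: "\<sigma> \<in> block_choices n k"
  shows "monomial (block_exponent n k \<sigma>) z = (\<Prod>i<k. z (i * n + \<sigma> i))"
proof -
  have "{j. block_exponent n k \<sigma> j \<noteq> 0} = (\<lambda>i. i * n + \<sigma> i) ` {..<k}"
    by (auto simp: block_exponent_def)
  moreover have "inj_on (\<lambda>i. i * n + \<sigma> i) {..<k}"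
  proof (rule inj_onI)
    fix i i' assume "i \<in> {..<k}" "i' \<in> {..<k}" "i * n + \<sigma> i = i' * n + \<sigma> i'"
    then show "i = i'" using block_index_eq_iff[of "\<sigma> i" n "\<sigma> i'"] \<sigma> by (auto simp: PiE_iff)
  qed
  moreover have "block_exponent n k \<sigma> (i * n + \<sigma> i) = 1" if "i < k" for i
    using that by (auto simp: block_exponent_def)
  ultimately show ?thesis
    by (simp add: monomial_def prod.reindex)
qed

lemma block_exponent_in_N0_inf: "block_exponent n k \<sigma> \<in> N0_inf"
proof -
  have "{j. block_exponent n k \<sigma> j \<noteq> 0} \<subseteq> (\<lambda>i. i * n + \<sigma> i) ` {..<k}"
    by (auto simp: block_exponent_def)
  then have "finite {j. block_exponent n k \<sigma> j \<noteq> 0}" by (rule finite_subset) simp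
  then show ?thesis by (simp add: N0_inf_def Z0_inf_def) (simp add: block_exponent_def)
qed

text \<open>The exponent determines the offsets below k, and the choices are extensional functions,
  so nothing else is left to determine. Hence sums over exponents can be rewritten as sums over
  choices.\<close>

lemma inj_on_block_exponent: "inj_on (block_exponent n k) (block_choices n k)"
proof (rule inj_onI)
  fix \<sigma> \<tau> assume \<sigma>: "\<sigma> \<in> block_choices n k" and \<tau>: "\<tau> \<in> block_choices n k"
    and eq: "block_exponent n k \<sigma> = block_exponent n k \<tau>"
  show "\<sigma> = \<tau>"
  proof (rule PiE_ext[OF \<sigma> \<tau>])
    fix i assume i: "i \<in> {..<k}"
    have "block_exponent n k \<tau> (i * n + \<sigma> i) = 1"
      using i unfolding eq[symmetric] by (auto simp: block_exponent_def)
    then obtain i' where "i' < k" "i * n + \<sigma> i = i' * n + \<tau> i'"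
      by (auto simp: block_exponent_def split: if_splits)
    then show "\<sigma> i = \<tau> i"
      using block_index_eq_iff[of "\<sigma> i" n "\<tau> i'" i i'] \<sigma> \<tau> i by (auto simp: PiE_iff)
  qed
qed

lemma prod_block_sum_expand:
  "(\<Prod>i<k. block_sum n i z) =
     (\<Sum>\<sigma>\<in>block_choices n k. monomial (block_exponent n k \<sigma>) z) / of_real (sqrt n) ^ k"
proof -
  have "(\<Prod>i<k. block_sum n i z) = (\<Prod>i<k. \<Sum>j<n. z (i * n + j)) / of_real (sqrt n) ^ k"
    by (simp add: block_sum_def steinhaus_sum_def prod_dividef)
  also have "(\<Prod>i<k. \<Sum>j<n. z (i * n + j)) = (\<Sum>\<sigma>\<in>block_choices n k. \<Prod>i<k. z (i * n + \<sigma> i))"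
    by (rule prod_sum_PiE) auto
  also have "\<dots> = (\<Sum>\<sigma>\<in>block_choices n k. monomial (block_exponent n k \<sigma>) z)"
    by (simp add: monomial_block_exponent)
  finally show ?thesis .
qed

text \<open>Non-negative integers with sum 1 consist of a single 1 and zeros. Applied to every
  block, this singles out one coordinate per block.\<close>

lemma ex_block_exponent:
  assumes \<alpha>: "\<alpha> \<in> N0_inf" and n: "0 < n"
    and deg: "\<And>i. i < k \<Longrightarrow> (\<Sum>j | \<alpha> j \<noteq> 0 \<and> j div n = i. \<alpha> j) = 1"
    and out: "\<And>j. k \<le> j div n \<Longrightarrow> \<alpha> j = 0"
  shows "\<exists>\<sigma>\<in>block_choices n k. \<alpha> = block_exponent n k \<sigma>"
proof -
  have nonneg: "\<alpha> j \<ge> 0" for j using \<alpha> by (simp add: N0_inf_def)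
  have fin: "finite {j. \<alpha> j \<noteq> 0 \<and> j div n = i}" for i
    using \<alpha> by (auto simp: N0_inf_def Z0_inf_def)
  have "\<exists>j. j div n = i \<and> (\<forall>j'. j' div n = i \<longrightarrow> \<alpha> j' = (if j' = j then 1 else 0))" if "i < k" for i
  proof -
    let ?D = "{j. \<alpha> j \<noteq> 0 \<and> j div n = i}"
    have "?D \<noteq> {}" using deg[OF that] by (metis sum.empty zero_neq_one)
    then obtain j where j: "j \<in> ?D" by blast
    then have "(\<Sum>j\<in>?D. \<alpha> j) = \<alpha> j + (\<Sum>j\<in>?D - {j}. \<alpha> j)"
      by (intro sum.remove fin)
    moreover have "\<alpha> j \<ge> 1" using j nonneg[of j] by simp
    moreover have ge: "(\<Sum>j\<in>?D - {j}. \<alpha> j) \<ge> 0" by (intro sum_nonneg nonneg)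
    ultimately have "\<alpha> j = 1" "(\<Sum>j\<in>?D - {j}. \<alpha> j) = 0"
      using deg[OF that] by linarith+
    then have rest: "\<alpha> j' = 0" if "j' \<in> ?D - {j}" for j'
      using that sum_nonneg_eq_0_iff[of "?D - {j}" \<alpha>] fin[of i] nonneg by blast
    have "\<alpha> j' = (if j' = j then 1 else 0)" if "j' div n = i" for j'
      using that \<open>\<alpha> j = 1\<close> rest[of j'] by (cases "\<alpha> j' = 0") auto
    moreover have "j div n = i" using j by simp
    ultimately show ?thesis by blast
  qed
  then have "\<forall>i. \<exists>j. i < k \<longrightarrow> j div n = i \<and> (\<forall>j'. j' div n = i \<longrightarrow> \<alpha> j' = (if j' = j then 1 else 0))"
    by blast
  from choice[OF this] obtain J where J: "\<And>i. i < k \<Longrightarrow> J i div n = i"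
      "\<And>i j. i < k \<Longrightarrow> j div n = i \<Longrightarrow> \<alpha> j = (if j = J i then 1 else 0)"
    by blast
  \<comment> \<open>\<open>J i\<close> is the only coordinate of block \<open>i\<close> with
    exponent 1; \<sigma> records its offset within the block.\<close>
  define \<sigma> where "\<sigma> = (\<lambda>i\<in>{..<k}. J i mod n)"
  have \<sigma>: "\<sigma> \<in> block_choices n k" using n by (auto simp: \<sigma>_def)
  have J_eq: "i * n + \<sigma> i = J i" if "i < k" for i
    using J(1)[OF that] that div_mult_mod_eq[of "J i" n] by (simp add: \<sigma>_def)
  have "\<alpha> j = block_exponent n k \<sigma> j" for j
  proof (cases "j div n < k")
    case True
    have "(\<exists>i<k. j = i * n + \<sigma> i) \<longleftrightarrow> j = J (j div n)"
    proof
      assume "\<exists>i<k. j = i * n + \<sigma> i"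
      then obtain i where "i < k" "j = J i" by (auto simp only: J_eq)
      then show "j = J (j div n)" using J(1) by simp
    next
      assume "j = J (j div n)"
      with True show "\<exists>i<k. j = i * n + \<sigma> i"
        by (intro exI[of _ "j div n"]) (simp only: J_eq[OF True])
    qed
    then show ?thesis
      using J(2)[OF True refl] by (simp add: block_exponent_def)
  next
    case False
    then have "\<not> (\<exists>i<k. j = i * n + \<sigma> i)"
      using J(1) by (auto simp only: J_eq)
    then show ?thesis using False out by (simp add: block_exponent_def)
  qed
  then show ?thesis using \<sigma> by blast
qed

text \<open>Equality case of Hoelder's inequality: \<open>f = dual_power r S\<close> satisfies \<open>f * cnj S = |S|^r\<close> and
  \<open>|f| = |S|^(r-1)\<close>. Since \<open>0 powr a = 0\<close>, both hold also where \<open>S = 0\<close>.\<close>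

definition dual_power :: "real \<Rightarrow> complex \<Rightarrow> complex" where
  "dual_power r w = of_real (cmod w powr (r - 2)) * w"

lemma measurable_dual_power [measurable]: "dual_power r \<in> borel_measurable borel"
  unfolding dual_power_def by measurable

lemma norm_dual_power: "cmod (dual_power r w) = cmod w powr (r - 1)"
proof (cases "w = 0")
  case False
  then have "cmod w powr (r - 1) = cmod w powr (r - 2) * cmod w powr 1"
    by (simp only: powr_add[symmetric]) simp
  with False show ?thesis by (simp add: dual_power_def norm_mult)
qed (simp add: dual_power_def)

lemma dual_power_mult_cnj: "dual_power r w * cnj w = of_real (cmod w powr r)"
proof (cases "w = 0")
  case False
  then have "cmod w powr r = cmod w powr (r - 2) * cmod w powr 2"
    by (simp only: powr_add[symmetric]) simp
  with False show ?thesis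
    by (simp add: dual_power_def mult.assoc complex_norm_square[symmetric])
qed (simp add: dual_power_def)

lemma dual_power_mult_unit: "cmod u = 1 \<Longrightarrow> dual_power r (u * w) = u * dual_power r w"
  by (simp add: dual_power_def norm_mult)

definition test_fun :: "real \<Rightarrow> nat \<Rightarrow> nat \<Rightarrow> (nat \<Rightarrow> complex) \<Rightarrow> complex" where
  "test_fun r n k z = (\<Prod>i<k. dual_power r (block_sum n i z))"

lemma measurable_test_fun [measurable]: "test_fun r n k \<in> borel_measurable torus_measure"
  unfolding test_fun_def by measurable

lemma norm_test_fun: "cmod (test_fun r n k z) = (\<Prod>i<k. cmod (block_sum n i z) powr (r - 1))"
  by (simp add: test_fun_def prod_norm[symmetric] norm_dual_power)

lemma norm_test_fun_le:
  assumes "z \<in> space torus_measure" "1 \<le> r"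
  shows "cmod (test_fun r n k z) \<le> (sqrt n powr (r - 1)) ^ k"
proof -
  have "(\<Prod>i<k. cmod (block_sum n i z) powr (r - 1)) \<le> (\<Prod>i<k. sqrt n powr (r - 1))"
    using assms by (intro prod_mono conjI powr_mono2 norm_block_sum_le) auto
  then show ?thesis by (simp add: norm_test_fun)
qed

lemma block_sum_rotate_block:
  assumes n: "0 < n"
  shows "block_sum n i (\<lambda>j. (if j \<in> {j. j div n = l} then u else 1) * z j)
     = (if i = l then u else 1) * block_sum n i z"
proof -
  have "(\<Sum>j<n. (if (i * n + j) div n = l then u else 1) * z (i * n + j))
     = (\<Sum>j<n. (if i = l then u else 1) * z (i * n + j))"
    by (intro sum.cong refl) simp
  then show ?thesis
    by (simp add: block_sum_def steinhaus_sum_def sum_distrib_left)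
qed

text \<open>Rotating one block by u multiplies the test function by u, so \<alpha> has degree 1 in
  each block; rotating a coordinate outside the blocks changes nothing, so \<alpha> vanishes there.
  Non-negativity of \<alpha> then removes all mixed frequencies such as a + b - c within a
  block.\<close>

lemma fourier_coeff_test_fun_nonzero:
  assumes \<alpha>: "\<alpha> \<in> N0_inf" and n: "0 < n" and nz: "fourier_coeff (test_fun r n k) \<alpha> \<noteq> 0"
  shows "\<alpha> \<in> block_exponent n k ` block_choices n k"
proof -
  have Z: "\<alpha> \<in> Z0_inf" using \<alpha> by (simp add: N0_inf_def)
  have deg: "(\<Sum>j | \<alpha> j \<noteq> 0 \<and> j \<in> {j. j div n = i}. \<alpha> j) = 1" if i: "i < k" for i
  proof (rule fourier_coeff_rotation[OF measurable_test_fun Z _ nz])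
    fix u :: complex and z assume u: "cmod u = 1"
    have "dual_power r ((if i' = i then u else 1) * w) = (if i' = i then u else 1) * dual_power r w" for i' w
      using u by (simp add: dual_power_mult_unit)
    then have "test_fun r n k (\<lambda>j. (if j \<in> {j. j div n = i} then u else 1) * z j)
       = (\<Prod>i'<k. (if i' = i then u else 1)) * test_fun r n k z"
      unfolding test_fun_def block_sum_rotate_block[OF n] by (simp only: prod.distrib)
    also have "(\<Prod>i'<k. (if i' = i then u else 1)) = u"
      using i by simp
    finally show "test_fun r n k (\<lambda>j. (if j \<in> {j. j div n = i} then u else 1) * z j)
       = u powi 1 * test_fun r n k z" by simp
  qed
  have out: "\<alpha> l = 0" if l: "k \<le> l div n" for l
  proof -
    have "(\<Sum>j | \<alpha> j \<noteq> 0 \<and> j \<in> {l}. \<alpha> j) = 0"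
    proof (rule fourier_coeff_rotation[OF measurable_test_fun Z _ nz])
      fix u :: complex and z
      have "block_sum n i (\<lambda>j. (if j \<in> {l} then u else 1) * z j) = block_sum n i z" if "i < k" for i
      proof -
        have "i * n + j \<noteq> l" if "j < n" for j
          using \<open>i < k\<close> l that by auto
        then show ?thesis
          by (simp add: block_sum_def steinhaus_sum_def)
      qed
      then show "test_fun r n k (\<lambda>j. (if j \<in> {l} then u else 1) * z j) = u powi 0 * test_fun r n k z"
        by (simp add: test_fun_def)
    qed
    moreover have "{j. \<alpha> j \<noteq> 0 \<and> j \<in> {l}} = (if \<alpha> l \<noteq> 0 then {l} else {})" by auto
    ultimately show ?thesis by (auto split: if_splits)
  qed
  show ?thesis
    using ex_block_exponent[OF \<alpha> n _ out] deg by auto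
qed

lemma fourier_coeff_test_fun_eq:
  assumes \<sigma>: "\<sigma> \<in> block_choices n k" and \<tau>: "\<tau> \<in> block_choices n k" and n: "0 < n"
  shows "fourier_coeff (test_fun r n k) (block_exponent n k \<sigma>) = fourier_coeff (test_fun r n k) (block_exponent n k \<tau>)"
proof -
  let ?t = "\<lambda>i. Transposition.transpose (\<sigma> i) (\<tau> i)"
  \<comment> \<open>Inside block i < k, \<pi> swaps the offsets \<sigma> i and \<tau> i; elsewhere
    it is the identity. It is an involution, it preserves every block sum, and it carries one
    monomial to the other.\<close>
  define \<pi> where "\<pi> j = (if j div n < k then (j div n) * n + ?t (j div n) (j mod n) else j)" for j
  have t_less: "?t i a < n" if "i < k" "a < n" for i a
    using that \<sigma> \<tau> by (auto simp: Transposition.transpose_def PiE_iff)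
  have \<pi>: "\<pi> (i * n + a) = i * n + ?t i a" if "i < k" "a < n" for i a
    using that by (simp add: \<pi>_def)
  have "\<pi> (\<pi> j) = j" for j
  proof (cases "j div n < k")
    case True
    then have "\<pi> j = (j div n) * n + ?t (j div n) (j mod n)" by (simp add: \<pi>_def)
    also have "\<pi> \<dots> = (j div n) * n + j mod n"
      using n True by (subst \<pi>) (auto intro: t_less)
    finally show ?thesis by simp
  qed (simp add: \<pi>_def)
  then have inj: "inj \<pi>" by (rule inj_on_inverseI)
  have "block_sum n i (\<lambda>j. z (\<pi> j)) = block_sum n i z" if i: "i < k" for i z
  proof -
    have "(\<Sum>a<n. z (i * n + ?t i a)) = (\<Sum>a<n. z (i * n + a))"
      by (rule sum.reindex_bij_witness[of _ "?t i" "?t i"]) (auto intro: t_less[OF i])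
    then show ?thesis
      by (simp add: block_sum_def steinhaus_sum_def \<pi>[OF i])
  qed
  then have f: "test_fun r n k (\<lambda>j. z (\<pi> j)) = test_fun r n k z" for z
    by (simp add: test_fun_def)
  have m: "monomial (block_exponent n k \<sigma>) (\<lambda>j. z (\<pi> j)) = monomial (block_exponent n k \<tau>) z" for z
    using \<sigma> by (auto simp: monomial_block_exponent[OF \<sigma>] monomial_block_exponent[OF \<tau>] \<pi> PiE_iff)
  have "fourier_coeff (test_fun r n k) (block_exponent n k \<sigma>) =
      (\<integral>z. test_fun r n k (\<lambda>j. z (\<pi> j)) * cnj (monomial (block_exponent n k \<sigma>) (\<lambda>j. z (\<pi> j))) \<partial>torus_measure)"
    unfolding fourier_coeff_def
    by (rule integral_torus_reindex[where F = "\<lambda>z. test_fun r n k z * cnj (monomial (block_exponent n k \<sigma>) z)", symmetric])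
       (auto intro: inj)
  then show ?thesis
    by (simp only: f m fourier_coeff_def)
qed

lemma integrable_test_fun_mult_cnj_monomial:
  assumes "1 \<le> r"
  shows "integrable torus_measure (\<lambda>z. test_fun r n k z * cnj (monomial \<alpha> z))"
proof -
  interpret T: prob_space torus_measure by (rule prob_space_torus_measure)
  have "cmod (monomial \<alpha> z) = 1" if "z \<in> space torus_measure" for z
    using that by (simp add: monomial_def space_torus_measure prod_norm[symmetric] norm_power_int)
  then show ?thesis
    using norm_test_fun_le[OF _ assms, of _ n k]
    by (intro T.integrable_const_bound[of _ "(sqrt n powr (r - 1)) ^ k"]) (auto simp: norm_mult)
qed

text \<open>The coefficients share one value c, so the sum is a multiple of the product of block
  sums. Integrating the test function against the conjugate of that product identifies the multiple,
  since the integrand is then the product of the |S_i|^r.\<close>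

lemma sum_fourier_coeff_test_fun:
  assumes r: "1 \<le> r" and n: "0 < n"
  shows "(\<Sum>\<sigma>\<in>block_choices n k. fourier_coeff (test_fun r n k) (block_exponent n k \<sigma>)
            * monomial (block_exponent n k \<sigma>) z)
    = of_real (\<integral>z. (\<Prod>i<k. cmod (block_sum n i z) powr r) \<partial>torus_measure) * (\<Prod>i<k. block_sum n i z)"
proof -
  let ?c = "\<lambda>\<sigma>. fourier_coeff (test_fun r n k) (block_exponent n k \<sigma>)"
  let ?N = "of_real (sqrt n) ^ k :: complex"
  let ?A = "\<integral>z. (\<Prod>i<k. cmod (block_sum n i z) powr r) \<partial>torus_measure"
  have N: "?N \<noteq> 0" using n by simp
  define \<tau> where "\<tau> = (\<lambda>i\<in>{..<k}. 0::nat)"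
  have \<tau>: "\<tau> \<in> block_choices n k" using n by (auto simp: \<tau>_def)
  have c: "?c \<sigma> = ?c \<tau>" if "\<sigma> \<in> block_choices n k" for \<sigma>
    by (rule fourier_coeff_test_fun_eq[OF that \<tau> n])
  have "complex_of_real ?A = (\<integral>z. complex_of_real (\<Prod>i<k. cmod (block_sum n i z) powr r) \<partial>torus_measure)"
    by (rule integral_complex_of_real[symmetric])
  also have "\<dots> = (\<integral>z. (\<Sum>\<sigma>\<in>block_choices n k. test_fun r n k z * cnj (monomial (block_exponent n k \<sigma>) z) / ?N) \<partial>torus_measure)"
  proof (rule Bochner_Integration.integral_cong[OF refl])
    fix z
    have "of_real (\<Prod>i<k. cmod (block_sum n i z) powr r) = test_fun r n k z * cnj (\<Prod>i<k. block_sum n i z)"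
      by (simp add: test_fun_def prod.distrib[symmetric] dual_power_mult_cnj)
    then show "of_real (\<Prod>i<k. cmod (block_sum n i z) powr r) =
        (\<Sum>\<sigma>\<in>block_choices n k. test_fun r n k z * cnj (monomial (block_exponent n k \<sigma>) z) / ?N)"
      unfolding prod_block_sum_expand by (simp add: sum_distrib_left sum_divide_distrib)
  qed
  also have "\<dots> = (\<Sum>\<sigma>\<in>block_choices n k. ?c \<sigma> / ?N)"
    unfolding fourier_coeff_def
    by (subst Bochner_Integration.integral_sum)
       (auto intro!: integrable_divide integrable_test_fun_mult_cnj_monomial r)
  also have "\<dots> = (\<Sum>\<sigma>\<in>block_choices n k. ?c \<tau> / ?N)"
    by (intro sum.cong refl) (simp only: c)
  also have "\<dots> = of_nat n ^ k * ?c \<tau> / ?N"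
    by (simp add: card_PiE)
  \<comment> \<open>There are n^k choices, which is the square of the normalising factor sqrt n ^ k;
    one power cancels and the other remains.\<close>
  also have "of_nat n ^ k = ?N * ?N"
    by (simp add: power_mult_distrib[symmetric] of_real_mult[symmetric] del: of_real_mult)
  finally have A: "of_real ?A = ?c \<tau> * ?N" using N by simp
  have "(\<Sum>\<sigma>\<in>block_choices n k. ?c \<sigma> * monomial (block_exponent n k \<sigma>) z)
      = ?c \<tau> * (\<Sum>\<sigma>\<in>block_choices n k. monomial (block_exponent n k \<sigma>) z)"
    unfolding sum_distrib_left by (intro sum.cong refl) (simp only: c)
  also have "\<dots> = ?c \<tau> * (?N * (\<Prod>i<k. block_sum n i z))"
    unfolding prod_block_sum_expand using N by simp
  finally show ?thesis unfolding A by (simp only: mult_ac)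
qed

lemma Lp_space_boundedI:
  assumes "prob_space M" and f[measurable]: "f \<in> borel_measurable M" and B: "\<And>x. x \<in> space M \<Longrightarrow> cmod (f x) \<le> B"
  shows "f \<in> Lp_space M p"
proof -
  interpret prob_space M by fact
  have "Lp_norm M p f < \<infinity>"
  proof (cases "p = \<infinity>")
    case True
    have "esssup M (\<lambda>x. ennreal (cmod (f x))) \<le> ennreal B"
      using B by (intro esssup_I) (auto intro!: ennreal_leI)
    also have "\<dots> < \<infinity>" by simp
    finally show ?thesis using True by (simp add: Lp_norm_def)
  next
    case False
    have "(\<integral>\<^sup>+x. ennreal (cmod (f x) powr enn2real p) \<partial>M) \<le> (\<integral>\<^sup>+x. ennreal (B powr enn2real p) \<partial>M)"
      using B by (intro nn_integral_mono ennreal_leI powr_mono2) auto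
    also have "\<dots> < \<infinity>" by (simp add: emeasure_space_1)
    finally show ?thesis using False by (simp add: Lp_norm_def Let_def)
  qed
  then show ?thesis by (simp add: Lp_space_def)
qed

text \<open>Only finitely many frequencies in \<open>N0_inf\<close> contribute, so every partial sum
  containing them equals the claimed projection exactly, and the convergence is eventual
  equality.\<close>

lemma is_riesz_projection_test_fun:
  assumes r: "1 \<le> r" and n: "0 < n"
  shows "is_riesz_projection (test_fun r n k)
     (\<lambda>z. of_real (\<integral>z. (\<Prod>i<k. cmod (block_sum n i z) powr r) \<partial>torus_measure) * (\<Prod>i<k. block_sum n i z))"
    (is "is_riesz_projection ?f ?g")
  unfolding is_riesz_projection_def
proof (intro conjI)
  show "?f \<in> Lp_space torus_measure 2"
    using norm_test_fun_le[OF _ r] by (intro Lp_space_boundedI prob_space_torus_measure) auto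
  let ?A = "\<integral>z. (\<Prod>i<k. cmod (block_sum n i z) powr r) \<partial>torus_measure"
  show "?g \<in> Lp_space torus_measure 2"
  proof (rule Lp_space_boundedI[OF prob_space_torus_measure])
    fix z assume "z \<in> space torus_measure"
    then have "(\<Prod>i<k. cmod (block_sum n i z)) \<le> (\<Prod>i<k. sqrt n)"
      by (intro prod_mono conjI norm_block_sum_le) auto
    then show "cmod (?g z) \<le> \<bar>?A\<bar> * sqrt n ^ k"
      unfolding norm_mult norm_of_real
      by (intro mult_left_mono) (simp_all add: prod_norm[symmetric])
  qed measurable
  let ?E = "block_exponent n k ` block_choices n k"
  have E: "finite ?E" "?E \<subseteq> N0_inf"
    by (auto intro!: finite_imageI finite_PiE block_exponent_in_N0_inf)
  have zero: "Lp_norm torus_measure 2 (\<lambda>z. ?g z - (\<Sum>\<alpha>\<in>F. fourier_coeff ?f \<alpha> * monomial \<alpha> z)) = 0"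
    if F: "finite F" "?E \<subseteq> F" "F \<subseteq> N0_inf" for F
  proof -
    have "fourier_coeff ?f \<alpha> = 0" if "\<alpha> \<in> F - ?E" for \<alpha>
      using that F(3) fourier_coeff_test_fun_nonzero[OF _ n] by blast
    then have "(\<Sum>\<alpha>\<in>F. fourier_coeff ?f \<alpha> * monomial \<alpha> z) = (\<Sum>\<alpha>\<in>?E. fourier_coeff ?f \<alpha> * monomial \<alpha> z)" for z
      using F by (intro sum.mono_neutral_right) auto
    also have "\<dots> z = ?g z" for z
      unfolding sum.reindex[OF inj_on_block_exponent] o_def by (rule sum_fourier_coeff_test_fun[OF r n])
    finally show ?thesis
      by (simp add: Lp_norm_def Let_def)
  qed
  have "\<forall>\<^sub>F F in finite_subsets_at_top N0_inf.
      Lp_norm torus_measure 2 (\<lambda>z. ?g z - (\<Sum>\<alpha>\<in>F. fourier_coeff ?f \<alpha> * monomial \<alpha> z)) = 0"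
    unfolding eventually_finite_subsets_at_top
    using E zero by (intro exI[of _ ?E]) auto
  then show "((\<lambda>F. Lp_norm torus_measure 2 (\<lambda>z. ?g z - (\<Sum>\<alpha>\<in>F. fourier_coeff ?f \<alpha> * monomial \<alpha> z)))
        \<longlongrightarrow> 0) (finite_subsets_at_top N0_inf)"
    by (rule tendsto_eventually)
qed

section \<open>Norm inflation\<close>

definition steinhaus_moment :: "real \<Rightarrow> nat \<Rightarrow> real" where
  "steinhaus_moment s n = (\<integral>z. cmod (steinhaus_sum n z) powr s \<partial>torus_measure)"

lemma steinhaus_moment_nonneg: "0 \<le> steinhaus_moment s n"
  by (simp add: steinhaus_moment_def)

lemma nn_integral_steinhaus_moment:
  assumes "0 \<le> s"
  shows "(\<integral>\<^sup>+z. ennreal (cmod (steinhaus_sum n z) powr s) \<partial>torus_measure) = ennreal (steinhaus_moment s n)"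
proof -
  interpret T: prob_space torus_measure by (rule prob_space_torus_measure)
  show ?thesis
    unfolding steinhaus_moment_def using norm_steinhaus_sum_le assms
    by (intro nn_integral_eq_integral T.integrable_const_bound[of _ "sqrt n powr s"])
       (auto intro!: powr_mono2)
qed

lemma nn_integral_block_moment:
  assumes "0 \<le> s"
  shows "(\<integral>\<^sup>+z. ennreal (\<Prod>i<k. cmod (block_sum n i z) powr s) \<partial>torus_measure) = ennreal (steinhaus_moment s n ^ k)"
  using nn_integral_prod_block_sum[of "\<lambda>w. ennreal (cmod w powr s)" n k]
  by (simp add: prod_ennreal nn_integral_steinhaus_moment[OF assms] ennreal_power steinhaus_moment_nonneg)

lemma integral_block_moment:
  assumes "0 \<le> s"
  shows "(\<integral>z. (\<Prod>i<k. cmod (block_sum n i z) powr s) \<partial>torus_measure) = steinhaus_moment s n ^ k"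
  by (subst integral_eq_nn_integral)
     (auto simp: nn_integral_block_moment[OF assms] steinhaus_moment_nonneg intro!: prod_nonneg)

lemma Lp_norm_finite:
  assumes "p \<noteq> \<infinity>" "0 \<le> I" "(\<integral>\<^sup>+x. ennreal (cmod (f x) powr enn2real p) \<partial>M) = ennreal I"
  shows "Lp_norm M p f = ennreal (I powr (1 / enn2real p))"
  using assms by (simp add: Lp_norm_def Let_def)

lemma Lp_norm_projection_test_fun:
  assumes p: "p \<noteq> \<infinity>" and P: "0 < enn2real p" and c: "0 \<le> c"
  shows "Lp_norm torus_measure p (\<lambda>z. of_real c * (\<Prod>i<k. block_sum n i z))
    = ennreal (c * (steinhaus_moment (enn2real p) n ^ k) powr (1 / enn2real p))"
proof -
  let ?P = "enn2real p"
  have eq: "cmod (of_real c * (\<Prod>i<k. block_sum n i z)) powr ?P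
      = c powr ?P * (\<Prod>i<k. cmod (block_sum n i z) powr ?P)" for z
    using c by (simp add: norm_mult prod_norm[symmetric] powr_mult prod_nonneg prod_powr_distrib)
  have "(\<integral>\<^sup>+z. ennreal (cmod (of_real c * (\<Prod>i<k. block_sum n i z)) powr ?P) \<partial>torus_measure)
      = (\<integral>\<^sup>+z. ennreal (c powr ?P) * ennreal (\<Prod>i<k. cmod (block_sum n i z) powr ?P) \<partial>torus_measure)"
    unfolding eq by (simp add: ennreal_mult')
  also have "\<dots> = ennreal (c powr ?P) * (\<integral>\<^sup>+z. ennreal (\<Prod>i<k. cmod (block_sum n i z) powr ?P) \<partial>torus_measure)"
    by (rule nn_integral_cmult) measurable
  also have "\<dots> = ennreal (c powr ?P * steinhaus_moment ?P n ^ k)"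
    using P by (simp add: nn_integral_block_moment ennreal_mult')
  finally have "Lp_norm torus_measure p (\<lambda>z. of_real c * (\<Prod>i<k. block_sum n i z))
      = ennreal ((c powr ?P * steinhaus_moment ?P n ^ k) powr (1 / ?P))"
    using p by (intro Lp_norm_finite) (auto simp: steinhaus_moment_nonneg)
  also have "(c powr ?P * steinhaus_moment ?P n ^ k) powr (1 / ?P) = c * (steinhaus_moment ?P n ^ k) powr (1 / ?P)"
    using P c by (simp add: powr_mult powr_powr steinhaus_moment_nonneg)
  finally show ?thesis .
qed

text \<open>For finite q the relation (r - 1) * q = r turns |f|^q into the product of the |S_i|^r.
  For q = \<infinity> the exponent 1 - 1/r is 0, and positivity of the moment makes the right side
  1.\<close>

lemma Lp_norm_test_fun_le:
  fixes q :: ennreal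
  assumes r: "1 \<le> r" and pos: "0 < steinhaus_moment r n"
    and conj: "q = \<infinity> \<and> r = 1 \<or> q \<noteq> \<infinity> \<and> 0 < enn2real q \<and> 1 / enn2real q = 1 - 1 / r"
  shows "Lp_norm torus_measure q (test_fun r n k) \<le> ennreal ((steinhaus_moment r n ^ k) powr (1 - 1 / r))"
proof (cases "q = \<infinity>")
  case True
  then have r1: "r = 1" using conj by simp
  \<comment> \<open>The factors have the form x powr 0, which is 1 for x > 0 and 0 for x =
    0.\<close>
  have "cmod (test_fun r n k z) \<le> 1" for z
    unfolding norm_test_fun r1 by (intro prod_le_1) auto
  then have "esssup torus_measure (\<lambda>z. ennreal (cmod (test_fun r n k z))) \<le> 1"
    by (intro esssup_I) auto
  then show ?thesis
    using True pos by (simp add: Lp_norm_def r1)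
next
  case False
  let ?Q = "enn2real q"
  have Q: "0 < ?Q" "1 / ?Q = 1 - 1 / r" using conj False by auto
  have "(r - 1) * ?Q = r"
    using Q r by (simp add: field_simps)
  then have eq: "cmod (test_fun r n k z) powr ?Q = (\<Prod>i<k. cmod (block_sum n i z) powr r)" for z
    by (simp add: norm_test_fun prod_powr_distrib powr_powr)
  have "(\<integral>\<^sup>+z. ennreal (cmod (test_fun r n k z) powr ?Q) \<partial>torus_measure) = ennreal (steinhaus_moment r n ^ k)"
    unfolding eq using r by (intro nn_integral_block_moment) simp
  then have "Lp_norm torus_measure q (test_fun r n k) = ennreal ((steinhaus_moment r n ^ k) powr (1 / ?Q))"
    using False by (intro Lp_norm_finite) (auto simp: steinhaus_moment_nonneg)
  then show ?thesis by (simp add: Q(2))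
qed

text \<open>With k blocks, the quotient of the two norms is at least the k-th power of a number x >
  1, which exceeds every constant.\<close>

lemma riesz_projection_unbounded_if_moments:
  fixes p q :: ennreal and r :: real
  assumes p: "p \<noteq> \<infinity>" and P: "0 < enn2real p" and r: "1 \<le> r"
    and conj: "q = \<infinity> \<and> r = 1 \<or> q \<noteq> \<infinity> \<and> 0 < enn2real q \<and> 1 / enn2real q = 1 - 1 / r"
    and n: "0 < n"
    and gt: "1 < steinhaus_moment (enn2real p) n powr (1 / enn2real p) * steinhaus_moment r n powr (1 / r)"
  shows "\<not> riesz_projection_bounded q p"
proof
  define a where "a = steinhaus_moment r n"
  define b where "b = steinhaus_moment (enn2real p) n"
  define x where "x = b powr (1 / enn2real p) * a powr (1 / r)"
  have x: "1 < x" using gt by (simp add: x_def a_def b_def)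
  \<comment> \<open>A zero moment would make the product in \<open>gt\<close> vanish, because
    \<open>0 powr t = 0\<close>.\<close>
  have a: "0 < a" and b: "0 < b"
    using gt steinhaus_moment_nonneg[of r n] steinhaus_moment_nonneg[of "enn2real p" n]
    by (auto simp: a_def b_def less_le)
  assume "riesz_projection_bounded q p"
  then obtain C :: real where C: "\<And>f g. f \<in> Lp_space torus_measure q \<Longrightarrow> is_riesz_projection f g \<Longrightarrow>
      Lp_norm torus_measure p g \<le> ennreal C * Lp_norm torus_measure q f"
    unfolding riesz_projection_bounded_def by blast
  \<comment> \<open>\<open>C\<close> may be negative; \<open>ennreal\<close> sends it to 0, so
    \<open>max C 0\<close> represents the same bound.\<close>
  obtain k where k: "max C 0 < x ^ k" using real_arch_pow[OF x] by blast
  let ?f = "test_fun r n k"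
  have Lq: "?f \<in> Lp_space torus_measure q"
    using norm_test_fun_le[OF _ r] by (intro Lp_space_boundedI prob_space_torus_measure) auto
  have "is_riesz_projection ?f (\<lambda>z. of_real (a ^ k) * (\<Prod>i<k. block_sum n i z))"
    using is_riesz_projection_test_fun[OF r n, of k] r by (simp add: integral_block_moment a_def)
  from C[OF Lq this]
  have "ennreal (a ^ k * (b ^ k) powr (1 / enn2real p)) \<le> ennreal C * Lp_norm torus_measure q ?f"
    using a by (subst (asm) Lp_norm_projection_test_fun[OF p P]) (auto simp: b_def)
  also have "\<dots> \<le> ennreal (max C 0) * ennreal ((a ^ k) powr (1 - 1 / r))"
    using a unfolding a_def by (intro mult_mono Lp_norm_test_fun_le r conj ennreal_leI) auto
  also have "\<dots> = ennreal (max C 0 * (a ^ k) powr (1 - 1 / r))"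
    by (simp add: ennreal_mult')
  finally have le: "a ^ k * (b ^ k) powr (1 / enn2real p) \<le> max C 0 * (a ^ k) powr (1 - 1 / r)"
    by (subst (asm) ennreal_le_iff) auto
  have pw: "(c ^ k) powr t = (c powr t) ^ k" if "0 < c" for c t :: real
    using that by (simp add: powr_realpow[symmetric] powr_powr mult.commute)
  \<comment> \<open>Of the factor a^k created by the projection, the power 1 - 1/r is used up by the
    norm of f and the power 1/r remains in x^k.\<close>
  have "a ^ k = (a ^ k) powr (1 / r) * (a ^ k) powr (1 - 1 / r)"
    using a by (simp add: powr_add[symmetric])
  then have "x ^ k * (a ^ k) powr (1 - 1 / r) = a ^ k * (b ^ k) powr (1 / enn2real p)"
    unfolding x_def power_mult_distrib pw[OF a, symmetric] pw[OF b, symmetric] by simp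
  with le have "x ^ k * (a ^ k) powr (1 - 1 / r) \<le> max C 0 * (a ^ k) powr (1 - 1 / r)" by simp
  then have "x ^ k \<le> max C 0" using a by simp
  with k show False by linarith
qed

text \<open>The strict inequality leaves room to shrink both Gamma values by a common factor t < 1.
  For large n both moments lie above the shrunken values simultaneously.\<close>

lemma riesz_projection_unbounded_if_Gamma:
  fixes p q :: ennreal and r :: real
  assumes p: "p \<noteq> \<infinity>" and P: "0 < enn2real p" and r: "1 \<le> r"
    and conj: "q = \<infinity> \<and> r = 1 \<or> q \<noteq> \<infinity> \<and> 0 < enn2real q \<and> 1 / enn2real q = 1 - 1 / r"
    and gt: "1 < Gamma (1 + enn2real p / 2) powr (1 / enn2real p) * Gamma (1 + r / 2) powr (1 / r)"
  shows "\<not> riesz_projection_bounded q p"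
proof -
  let ?P = "enn2real p"
  define G1 where "G1 = Gamma (1 + ?P / 2)"
  define G2 where "G2 = Gamma (1 + r / 2)"
  have G: "0 < G1" "0 < G2" using P r by (auto simp: G1_def G2_def intro!: Gamma_real_pos add_pos_pos)
  have "((\<lambda>t. (t * G1) powr (1 / ?P) * (t * G2) powr (1 / r)) \<longlongrightarrow> (1 * G1) powr (1 / ?P) * (1 * G2) powr (1 / r)) (at_left (1::real))"
    using G by (intro tendsto_intros) auto
  then have "\<forall>\<^sub>F t in at_left (1::real). 1 < (t * G1) powr (1 / ?P) * (t * G2) powr (1 / r)"
    by (rule order_tendstoD) (use gt in \<open>simp add: G1_def G2_def\<close>)
  moreover have "\<forall>\<^sub>F t in at_left (1::real). 0 < t \<and> t < 1"
    using eventually_at_left_real[of 0 "1::real"] by (auto elim: eventually_mono)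
  ultimately have "\<forall>\<^sub>F t in at_left (1::real). 0 < t \<and> t < 1 \<and> 1 < (t * G1) powr (1 / ?P) * (t * G2) powr (1 / r)"
    by eventually_elim simp
  then obtain t where t: "0 < t" "t < 1" "1 < (t * G1) powr (1 / ?P) * (t * G2) powr (1 / r)"
    using eventually_happens'[of "at_left (1::real)"] trivial_limit_at_left_real by blast
  have ev1: "\<forall>\<^sub>F n in sequentially. ennreal (t * G1) < ennreal (steinhaus_moment ?P n)"
    using steinhaus_moment_liminf[OF P, of "t * G1"] G t P
    by (simp add: nn_integral_steinhaus_moment G1_def)
  have ev2: "\<forall>\<^sub>F n in sequentially. ennreal (t * G2) < ennreal (steinhaus_moment r n)"
    using steinhaus_moment_liminf[of r "t * G2"] G t r
    by (simp add: nn_integral_steinhaus_moment G2_def)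
  have "\<forall>\<^sub>F n in sequentially. 0 < n \<and> t * G1 < steinhaus_moment ?P n \<and> t * G2 < steinhaus_moment r n"
    using ev1 ev2 eventually_gt_at_top[of 0]
    by eventually_elim (use G t in \<open>simp add: ennreal_less_iff\<close>)
  then obtain n where n: "0 < n" "t * G1 < steinhaus_moment ?P n" "t * G2 < steinhaus_moment r n"
    by (auto simp: eventually_sequentially)
  have "(t * G1) powr (1 / ?P) * (t * G2) powr (1 / r)
      \<le> steinhaus_moment ?P n powr (1 / ?P) * steinhaus_moment r n powr (1 / r)"
    using n t G P r by (intro mult_mono powr_mono2) auto
  with t(3) show ?thesis
    by (intro riesz_projection_unbounded_if_moments[OF p P r conj n(1)]) simp
qed

section \<open>Infinite exponents and conversion to real exponents\<close>

lemma Lp_norm_le_esssup: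
  fixes M :: "'a measure"
  assumes "prob_space M" "f \<in> borel_measurable M" "p \<noteq> \<infinity>" "0 < enn2real p"
  shows "Lp_norm M p f \<le> Lp_norm M \<infinity> f"
proof (cases "Lp_norm M \<infinity> f")
  case (real B)
  interpret prob_space M by fact
  have "AE x in M. ennreal (cmod (f x)) \<le> ennreal B"
    using esssup_AE[where M = M and f = "\<lambda>x. ennreal (cmod (f x))"] real by (simp add: Lp_norm_def)
  then have "(\<integral>\<^sup>+x. ennreal (cmod (f x) powr enn2real p) \<partial>M) \<le> (\<integral>\<^sup>+x. ennreal (B powr enn2real p) \<partial>M)"
    using real by (intro nn_integral_mono_AE) (auto elim!: eventually_mono intro!: ennreal_leI powr_mono2)
  also have "\<dots> = ennreal (B powr enn2real p)" by (simp add: emeasure_space_1)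
  finally obtain I where I: "0 \<le> I" "(\<integral>\<^sup>+x. ennreal (cmod (f x) powr enn2real p) \<partial>M) = ennreal I" "I \<le> B powr enn2real p"
    by (cases "\<integral>\<^sup>+x. ennreal (cmod (f x) powr enn2real p) \<partial>M") (auto simp: top_unique)
  have "I powr (1 / enn2real p) \<le> (B powr enn2real p) powr (1 / enn2real p)"
    using I assms by (intro powr_mono2) auto
  also have "\<dots> = B" using real assms by (simp add: powr_powr)
  finally show ?thesis
    using real Lp_norm_finite[OF assms(3) I(1,2)] by (simp add: ennreal_leI)
qed simp

text \<open>On a probability space the norms increase with the exponent. Read contrapositively,
  unboundedness into a space with finite exponent gives unboundedness for the exponent
  \<infinity>.\<close>

lemma riesz_projection_bounded_infinity_imp:
  assumes "riesz_projection_bounded q \<infinity>" "p \<noteq> \<infinity>" "0 < enn2real p"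
  shows "riesz_projection_bounded q p"
proof -
  have "Lp_norm torus_measure p g \<le> Lp_norm torus_measure \<infinity> g" if "is_riesz_projection f g" for f g
    using that assms(2,3) by (intro Lp_norm_le_esssup prob_space_torus_measure) (auto simp: is_riesz_projection_def Lp_space_def)
  with assms(1) show ?thesis
    unfolding riesz_projection_bounded_def by (meson order_trans)
qed

text \<open>The case q = \<infinity> is kept apart because \<open>enn2real\<close> sends \<infinity>
  to 0. The value r = 0 is impossible since its inverse is \<infinity>, and r = \<infinity> would
  force q = 1.\<close>

lemma conjugate_exponent_cases:
  fixes q r :: ennreal
  assumes "2 \<le> q" and conj: "inverse q + inverse r = 1"
  shows "\<exists>R\<ge>1. r = ennreal R \<and>
    (q = \<infinity> \<and> R = 1 \<or> q \<noteq> \<infinity> \<and> 0 < enn2real q \<and> 1 / enn2real q = 1 - 1 / R)"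
proof -
  have r0: "r \<noteq> 0" using conj by (cases "r = 0") auto
  show ?thesis
  proof (cases q)
    case top
    then have inv: "inverse r = 1" using conj by simp
    then obtain R where R: "r = ennreal R" "0 \<le> R" by (cases r) auto
    then have "0 < R" using r0 by (cases "R = 0") auto
    then have "ennreal (inverse R) = ennreal 1" using inv R by (simp add: inverse_ennreal)
    then have "R = 1" using \<open>0 < R\<close> by (subst (asm) ennreal_inj) auto
    with top R show ?thesis by (intro exI[of _ 1]) auto
  next
    case (real Q)
    then have Q: "2 \<le> Q" using assms(1) by (metis ennreal_le_iff ennreal_numeral)
    show ?thesis
    proof (cases r)
      case top
      then have "ennreal (inverse Q) = ennreal 1" using conj real Q by (simp add: inverse_ennreal)
      then show ?thesis using Q by (simp add: ennreal_eq_1 field_simps)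
    next
      case (real R)
      then have R: "0 < R" using r0 by (cases "R = 0") auto
      have "ennreal (inverse Q + inverse R) = ennreal 1"
        using conj real \<open>q = ennreal Q\<close> Q R by (simp add: inverse_ennreal)
      then have eq: "inverse Q + inverse R = 1"
        using Q R by (subst (asm) ennreal_inj) auto
      then have "inverse R \<le> 1" using Q by (smt (verit) inverse_nonnegative_iff_nonnegative)
      then have "1 \<le> R" using R by (simp add: inverse_le_1_iff)
      then show ?thesis
        using eq real \<open>q = ennreal Q\<close> Q R by (intro exI[of _ R]) (auto simp: inverse_eq_divide)
    qed
  qed
qed

theorem theorem3:
  fixes p q r :: ennreal
  assumes "2 \<le> p" and "p \<le> q" and "q \<le> \<infinity>"
    and "inverse q + inverse r = 1"
    and "gamma_root p * gamma_root r > 1"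
  shows "\<not> riesz_projection_bounded q p"
proof -
  have "2 \<le> q" using assms by (metis order_trans)
  then obtain R where R: "1 \<le> R" "r = ennreal R"
    and conj: "q = \<infinity> \<and> R = 1 \<or> q \<noteq> \<infinity> \<and> 0 < enn2real q \<and> 1 / enn2real q = 1 - 1 / R"
    using conjugate_exponent_cases assms(4) by blast
  show ?thesis
  proof (cases p)
    case (real P)
    then have P: "2 \<le> P" using assms(1) by (metis ennreal_le_iff ennreal_numeral)
    have "gamma_root p * gamma_root r = ennreal (Gamma (1 + P / 2) powr (1 / P) * Gamma (1 + R / 2) powr (1 / R))"
      using real R by (simp add: gamma_root_def ennreal_mult')
    then have "1 < Gamma (1 + P / 2) powr (1 / P) * Gamma (1 + R / 2) powr (1 / R)"
      using assms(5) by (simp add: ennreal_less_iff flip: ennreal_1)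
    then show ?thesis
      using real P by (intro riesz_projection_unbounded_if_Gamma[OF _ _ R(1) conj]) auto
  next
    case top
    then have q: "q = \<infinity>" "R = 1" using assms(2) conj by (auto simp: top_unique)
    have "Gamma (3/2 :: real) = 1/2 * Gamma (1/2)"
      using Gamma_plus1[of "1/2::real"] nonpos_Ints_nonpos[of "1/2::real"] by auto
    then have G: "sqrt pi / 2 = Gamma (3/2 :: real)"
      by (simp add: Gamma_one_half_real)
    have "Gamma (3::real) = 2"
      using Gamma_fact[of 2, where 'a=real] by (simp add: numeral_2_eq_2)
    \<comment> \<open>This is the Gamma condition for the exponents 4 and 1, with Gamma 3 = 2 and
      Gamma (3/2) = sqrt pi / 2. Its fourth power reads 1 < pi^2 / 8.\<close>
    moreover have "1 < 2 powr (1/4) * (sqrt pi / 2)"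
    proof -
      have "(2 powr (1/4) * (sqrt pi / 2)) ^ 4 = pi ^ 2 / 8"
      proof -
        have "(2 powr (1/4)) ^ 4 = (2::real)" by (simp add: powr_power)
        moreover have "(sqrt pi) ^ 4 = pi ^ 2" by (simp add: power4_eq_xxxx power2_eq_square)
        ultimately show ?thesis by (simp add: power_mult_distrib power_divide)
      qed
      moreover have "8 < pi ^ 2"
      proof -
        have "(3::real) ^ 2 < pi ^ 2" using pi_gt3 by (intro power_strict_mono) auto
        then show ?thesis by simp
      qed
      ultimately have "1 ^ 4 < (2 powr (1/4) * (sqrt pi / 2)) ^ 4" by simp
      then show ?thesis by (rule power_less_imp_less_base) simp
    qed
    ultimately have "\<not> riesz_projection_bounded q 4"
      using q unfolding G by (intro riesz_projection_unbounded_if_Gamma[of 4 1 q]) auto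
    then show ?thesis
      using riesz_projection_bounded_infinity_imp[of q 4] top by auto
  qed
qed

end
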